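(* Assume that $d,s\to\infty$ and $0<\delta,\alpha<1$ are fixed. Let $\alpha'=\gamma\alpha$ for any constant $0<\gamma<1$. (1) If $\phi^{**}\le a/\sigma\le\sqrt{2\log(d/A_d-1)}$ for some sequence $A_d\le s$ satisfying $A_d\to\infty$ and $d/A_d\to\infty$, then $$\liminf_{d,s\to\infty}\ \inf_{M\in\mathcal M}\frac{\sup_{1\le j\le d}\sup_{\theta\in\Theta(s,a)}\mathbb E_\theta(U_j-L_j)}{\sigma\sqrt{2\log d}/2}\ge1 .$$ Moreover $\bar M^{TS}_{\alpha'}\in\mathcal M$ and $$\limsup_{d,s\to\infty}\frac{\sup_{1\le j\le d}\sup_{\theta\in\Theta(s,a)}\mathbb E_\theta(\bar U^{TS}_j-\bar L^{TS}_j)}{2\sigma\sqrt{2\log d}}\le1 .$$ (2) If $$\frac a\sigma\ge\sqrt{2\log(d-s)-\log\log(d-s)+C'}+\sqrt{2\log s-\log\log s+C'}$$ for some sufficiently large positive constant $C'$, then $$\liminf_{d,s\to\infty}\ \inf_{M\in\mathcal M}\frac{\sup_{1\le j\le d}\sup_{\theta\in\Theta(s,a)}\mathbb E_\theta(U_j-L_j)}{\sigma\sqrt{2\log s}/2}\ge1,$$ and the sparse confidence set $\bar M^{TS}_{\alpha'}$ satisfies $\bar M^{TS}_{\alpha'}\in\mathcal M$ and $$\limsup_{d,s\to\infty}\frac{\sup_{1\le j\le d}\sup_{\theta\in\Theta(s,a)}\mathbb E_\theta(\bar U^{TS}_j-\bar L^{TS}_j)}{2\sigma\sqrt{2\log s}}\le1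 .$$
   Context: $X=(X_1,\dots,X_d)\sim N(\theta,\sigma^2 I_d)$ with $\theta\in\mathbb R^d$ unknown and $\sigma$ known; $\mathbb P_\theta,\mathbb E_\theta$ are the corresponding probability and expectation. $\Phi$ is the standard normal c.d.f., $[d]=\{1,\dots,d\}$, $\|\theta\|_0=|\{j:\theta_j\neq0\}|$. The parameter space is $\Theta(s,a)=\{\theta\in\mathbb R^d:\|\theta\|_0\le s,\ \min_{j:\theta_j\neq0}|\theta_j|\ge a>0\}$. In asymptotic statements $a/\sigma$ may vary with $(d,s)$. For a random subset $S=S(X)\subseteq[d]$ and bounds $L_j=L_j(X)$, $U_j=U_j(X)$, $$M(S,U,L)=\{\theta\in\mathbb R^d:\ \theta_j=0\text{ for all }j\in S^c,\ \theta_j\in[L_j,U_j]\text{ for all }j\in S\}.$$ $CI$ is the class of all $M(S,U,L)$ such that $L_j,U_j$ depend only on $X_j$, $L_j\le U_j$, and $L_j=U_j=0$ for $j\notin S$. $\mathcal F(\delta)$ is the class of random subsets $S=S(X)\subseteq[d]$ such that for every $j\in[d]$: the event $\{j\in S(X)\}$ depends only on $X_j$, and $\mathbb P_0(j\in S(X))\le1-\delta$, where $\mathbb P_0$ is the probability when $X_j\sim N(0,\sigma^2)$. The class $\mathcal M$ is $$\mathcal M=\Big\{M(S,U,L)\in CI:\ \liminf_{d,s\to\infty}\inf_{\theta\in\Theta(s,a)}\mathbb P_\theta(\theta\in M(S,U,L))\ge1-\alpha,\ \text{and } S\in\mathcal F(\delta)\Big\}.$$ Put $C_{x,\beta}=2\sqrt{\pi\log(x/\beta)}$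 and $$\phi^{**}=\Phi^{-1}\Big(\frac{1+\delta}2\Big)+\sqrt{2\log\Big(\frac{2s}{C_{2s,\alpha'}\alpha'}\Big)},\qquad\bar\phi=\sqrt{2\log\Big(\frac{4(d-s)}{(\alpha-\alpha')C_{2(d-s),\alpha-\alpha'}}\Big)}+\sqrt{2\log\Big(\frac{2s}{C_{2s,\alpha'}\alpha'}\Big)}.$$ The set $\bar M^{TS}_{\alpha'}=M(\bar S^{TS}_{\alpha'},\bar U^{TS},\bar L^{TS})$ has $\bar L^{TS}_j=X_j-\bar u^{TS}_{\alpha'}\sigma$, $\bar U^{TS}_j=X_j+\bar u^{TS}_{\alpha'}\sigma$ for $j\in\bar S^{TS}_{\alpha'}$, and $\bar L^{TS}_j=\bar U^{TS}_j=0$ otherwise, where: (i) when $\phi^{**}\le a/\sigma<\bar\phi$: $j\in\bar S^{TS}_{\alpha'}$ iff $|X_j/\sigma|\ge\Phi^{-1}((\delta+1)/2)$, and $\bar u^{TS}_{\alpha'}=\sqrt{2\log\Big(\frac{2d}{(\alpha-\alpha')C_{2d,\alpha-\alpha'}}\Big)}$; (ii) when $a/\sigma\ge\bar\phi$: $j\in\bar S^{TS}_{\alpha'}$ iff $|X_j/\sigma|\ge\sqrt{2\log\Big(\frac{4(d-s)}{(\alpha-\alpha')C_{2(d-s),\alpha-\alpha'}}\Big)}$, and $\bar u^{TS}_{\alpha'}=\sqrt{2\log\Big(\frac{4s}{(\alpha-\alpha')C_{2s,\alpha-\alpha'}}\Big)}$.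
   Formalization: In (2), M^TS ∈ 𝓜 is claimed only when d−s is eventually at least a constant N(α,δ,γ) (false for d−s=2 with δ near 1); liminf inf over 𝓜 is read as the infimum over sequences of procedures in 𝓜 of the liminf, the literal infimum at fixed (d,s) being 0. *)

theory Defs
  imports "HOL-Probability.Probability"
begin

text \<open>
  The limit in the dimension \<open>d\<close> and the sparsity \<open>s\<close> is taken along arbitrary sequences
  \<open>d n\<close>, \<open>s n\<close> tending to infinity; the signal strength \<open>a n\<close> and the noise level \<open>\<sigma> n\<close> may
  vary as well.  A point of \<open>\<real>\<^sup>d\<close> is an extensional function on \<open>{1..d}\<close>, so that
  \<open>Rvec d\<close> is the space of the product measure \<open>gauss_model\<close>.
\<close>

definition Rvec :: "nat \<Rightarrow> (nat \<Rightarrow> real) set" where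
  "Rvec d = {1..d} \<rightarrow>\<^sub>E UNIV"

definition gauss_model :: "nat \<Rightarrow> (nat \<Rightarrow> real) \<Rightarrow> real \<Rightarrow> (nat \<Rightarrow> real) measure" where
  "gauss_model d \<theta> \<sigma> = Pi\<^sub>M {1..d} (\<lambda>j. density lborel (\<lambda>x. ennreal (normal_density (\<theta> j) \<sigma> x)))"

definition l0_norm :: "nat \<Rightarrow> (nat \<Rightarrow> real) \<Rightarrow> nat" where
  "l0_norm d \<theta> = card {j \<in> {1..d}. \<theta> j \<noteq> 0}"

definition Theta :: "nat \<Rightarrow> nat \<Rightarrow> real \<Rightarrow> (nat \<Rightarrow> real) set" where
  "Theta d s a = {\<theta> \<in> Rvec d. l0_norm d \<theta> \<le> s \<and> (\<forall>j\<in>{1..d}. \<theta> j \<noteq> 0 \<longrightarrow> a \<le> \<bar>\<theta> j\<bar>)}"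

definition Phi :: "real \<Rightarrow> real" where
  "Phi = cdf std_normal_distribution"

text \<open>Only meaningful on \<open>(0, 1)\<close>, where \<open>Phi\<close> has a unique preimage.\<close>

definition Phi_inv :: "real \<Rightarrow> real" where
  "Phi_inv = inv Phi"

text \<open>
  At sample size \<open>d\<close> a procedure consists of \<open>S x \<subseteq> {1..d}\<close> and bounds \<open>U x j\<close>, \<open>L x j\<close>, all
  functions of the observation \<open>x\<close>.
\<close>

type_synonym selector = "(nat \<Rightarrow> real) \<Rightarrow> nat set"
type_synonym bound = "(nat \<Rightarrow> real) \<Rightarrow> nat \<Rightarrow> real"

definition conf_set :: "nat \<Rightarrow> selector \<Rightarrow> bound \<Rightarrow> bound \<Rightarrow> (nat \<Rightarrow> real) \<Rightarrow> (nat \<Rightarrow> real) set" where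
  "conf_set d S U L x = {\<theta> \<in> Rvec d. (\<forall>j\<in>{1..d} - S x. \<theta> j = 0) \<and> (\<forall>j\<in>S x. \<theta> j \<in> {L x j..U x j})}"

text \<open>
  A random variable (event) depends only on \<open>X\<^sub>j\<close> if it is a Borel function of (a Borel
  condition on) the \<open>j\<close>-th coordinate.
\<close>

definition CI_class :: "nat \<Rightarrow> selector \<Rightarrow> bound \<Rightarrow> bound \<Rightarrow> bool" where
  "CI_class d S U L \<longleftrightarrow>
     (\<forall>x\<in>Rvec d. S x \<subseteq> {1..d}) \<and>
     (\<forall>j\<in>{1..d}. \<exists>u\<in>borel_measurable borel. \<forall>x\<in>Rvec d. U x j = u (x j)) \<and>
     (\<forall>j\<in>{1..d}. \<exists>l\<in>borel_measurable borel. \<forall>x\<in>Rvec d. L x j = l (x j)) \<and>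
     (\<forall>x\<in>Rvec d. \<forall>j\<in>{1..d}. L x j \<le> U x j) \<and>
     (\<forall>x\<in>Rvec d. \<forall>j\<in>{1..d} - S x. L x j = 0 \<and> U x j = 0)"

definition F_class :: "nat \<Rightarrow> real \<Rightarrow> real \<Rightarrow> selector \<Rightarrow> bool" where
  "F_class d \<sigma> \<delta> S \<longleftrightarrow>
     (\<forall>x\<in>Rvec d. S x \<subseteq> {1..d}) \<and>
     (\<forall>j\<in>{1..d}.
        (\<exists>B\<in>sets borel. \<forall>x\<in>Rvec d. j \<in> S x \<longleftrightarrow> x j \<in> B) \<and>
        measure (gauss_model d (\<lambda>k\<in>{1..d}. 0) \<sigma>) {x \<in> Rvec d. j \<in> S x} \<le> 1 - \<delta>)"

definition min_coverage ::
    "nat \<Rightarrow> nat \<Rightarrow> real \<Rightarrow> real \<Rightarrow> selector \<Rightarrow> bound \<Rightarrow> bound \<Rightarrow> ereal" where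
  "min_coverage d s a \<sigma> S U L =
     (INF \<theta>\<in>Theta d s a. ereal (measure (gauss_model d \<theta> \<sigma>) {x \<in> Rvec d. \<theta> \<in> conf_set d S U L x}))"

text \<open>
  The coverage requirement is asymptotic, so the members of the class are sequences of
  procedures; the structural requirements are imposed for all large \<open>n\<close>.
\<close>

definition M_class ::
    "(nat \<Rightarrow> nat) \<Rightarrow> (nat \<Rightarrow> nat) \<Rightarrow> (nat \<Rightarrow> real) \<Rightarrow> (nat \<Rightarrow> real) \<Rightarrow> real \<Rightarrow> real \<Rightarrow>
     ((nat \<Rightarrow> selector) \<times> (nat \<Rightarrow> bound) \<times> (nat \<Rightarrow> bound)) set" where
  "M_class d s a \<sigma> \<alpha> \<delta> =
     {(S, U, L).
        (\<forall>\<^sub>F n in sequentially. CI_class (d n) (S n) (U n) (L n)) \<and>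
        (\<forall>\<^sub>F n in sequentially. F_class (d n) (\<sigma> n) \<delta> (S n)) \<and>
        ereal (1 - \<alpha>) \<le> liminf (\<lambda>n. min_coverage (d n) (s n) (a n) (\<sigma> n) (S n) (U n) (L n))}"

text \<open>
  The expectation is taken as a nonnegative integral since it may be infinite; no truncation
  is involved for procedures in \<open>CI_class\<close>, for which \<open>L \<le> U\<close>.
\<close>

definition max_length :: "nat \<Rightarrow> nat \<Rightarrow> real \<Rightarrow> real \<Rightarrow> bound \<Rightarrow> bound \<Rightarrow> ennreal" where
  "max_length d s a \<sigma> U L =
     (SUP j\<in>{1..d}. SUP \<theta>\<in>Theta d s a. \<integral>\<^sup>+ x. ennreal (U x j - L x j) \<partial>gauss_model d \<theta> \<sigma>)"

definition C_const :: "real \<Rightarrow> real \<Rightarrow> real" where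
  "C_const x \<beta> = 2 * sqrt (pi * ln (x / \<beta>))"

definition phi_ss :: "nat \<Rightarrow> real \<Rightarrow> real \<Rightarrow> real" where
  "phi_ss s \<alpha>' \<delta> =
     Phi_inv ((1 + \<delta>) / 2) + sqrt (2 * ln (2 * real s / (C_const (2 * real s) \<alpha>' * \<alpha>')))"

definition phi_bar :: "nat \<Rightarrow> nat \<Rightarrow> real \<Rightarrow> real \<Rightarrow> real" where
  "phi_bar d s \<alpha> \<alpha>' =
     sqrt (2 * ln (4 * (real d - real s) / ((\<alpha> - \<alpha>') * C_const (2 * (real d - real s)) (\<alpha> - \<alpha>'))))
     + sqrt (2 * ln (2 * real s / (C_const (2 * real s) \<alpha>' * \<alpha>')))"

text \<open>
  The two-stage procedure.  It is meant for \<open>phi_ss s \<alpha>' \<delta> \<le> a / \<sigma>\<close> only; its first regime is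
  extended to smaller \<open>a / \<sigma>\<close> to make the definitions total.
\<close>

definition TS_threshold :: "nat \<Rightarrow> nat \<Rightarrow> real \<Rightarrow> real \<Rightarrow> real \<Rightarrow> real \<Rightarrow> real \<Rightarrow> real" where
  "TS_threshold d s a \<sigma> \<alpha> \<alpha>' \<delta> =
     (if a / \<sigma> < phi_bar d s \<alpha> \<alpha>' then Phi_inv ((\<delta> + 1) / 2)
      else sqrt (2 * ln (4 * (real d - real s) /
                         ((\<alpha> - \<alpha>') * C_const (2 * (real d - real s)) (\<alpha> - \<alpha>')))))"

definition TS_halfwidth :: "nat \<Rightarrow> nat \<Rightarrow> real \<Rightarrow> real \<Rightarrow> real \<Rightarrow> real \<Rightarrow> real" where
  "TS_halfwidth d s a \<sigma> \<alpha> \<alpha>' =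
     (if a / \<sigma> < phi_bar d s \<alpha> \<alpha>'
      then sqrt (2 * ln (2 * real d / ((\<alpha> - \<alpha>') * C_const (2 * real d) (\<alpha> - \<alpha>'))))
      else sqrt (2 * ln (4 * real s / ((\<alpha> - \<alpha>') * C_const (2 * real s) (\<alpha> - \<alpha>')))))"

definition TS_S :: "nat \<Rightarrow> nat \<Rightarrow> real \<Rightarrow> real \<Rightarrow> real \<Rightarrow> real \<Rightarrow> real \<Rightarrow> selector" where
  "TS_S d s a \<sigma> \<alpha> \<alpha>' \<delta> x = {j \<in> {1..d}. TS_threshold d s a \<sigma> \<alpha> \<alpha>' \<delta> \<le> \<bar>x j / \<sigma>\<bar>}"

definition TS_U :: "nat \<Rightarrow> nat \<Rightarrow> real \<Rightarrow> real \<Rightarrow> real \<Rightarrow> real \<Rightarrow> real \<Rightarrow> bound" where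
  "TS_U d s a \<sigma> \<alpha> \<alpha>' \<delta> x j =
     (if j \<in> TS_S d s a \<sigma> \<alpha> \<alpha>' \<delta> x then x j + TS_halfwidth d s a \<sigma> \<alpha> \<alpha>' * \<sigma> else 0)"

definition TS_L :: "nat \<Rightarrow> nat \<Rightarrow> real \<Rightarrow> real \<Rightarrow> real \<Rightarrow> real \<Rightarrow> real \<Rightarrow> bound" where
  "TS_L d s a \<sigma> \<alpha> \<alpha>' \<delta> x j =
     (if j \<in> TS_S d s a \<sigma> \<alpha> \<alpha>' \<delta> x then x j - TS_halfwidth d s a \<sigma> \<alpha> \<alpha>' * \<sigma> else 0)"

definition TS_in_M ::
    "(nat \<Rightarrow> nat) \<Rightarrow> (nat \<Rightarrow> nat) \<Rightarrow> (nat \<Rightarrow> real) \<Rightarrow> (nat \<Rightarrow> real) \<Rightarrow> real \<Rightarrow> real \<Rightarrow> real \<Rightarrow> bool" where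
  "TS_in_M d s a \<sigma> \<alpha> \<alpha>' \<delta> \<longleftrightarrow>
     (\<lambda>n. TS_S (d n) (s n) (a n) (\<sigma> n) \<alpha> \<alpha>' \<delta>,
      \<lambda>n. TS_U (d n) (s n) (a n) (\<sigma> n) \<alpha> \<alpha>' \<delta>,
      \<lambda>n. TS_L (d n) (s n) (a n) (\<sigma> n) \<alpha> \<alpha>' \<delta>) \<in> M_class d s a \<sigma> \<alpha> \<delta>"

definition asymptotic_setting ::
    "(nat \<Rightarrow> nat) \<Rightarrow> (nat \<Rightarrow> nat) \<Rightarrow> (nat \<Rightarrow> real) \<Rightarrow> (nat \<Rightarrow> real) \<Rightarrow> bool" where
  "asymptotic_setting d s a \<sigma> \<longleftrightarrow>
     filterlim d at_top sequentially \<and> filterlim s at_top sequentially \<and>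
     (\<forall>n. 0 < a n) \<and> (\<forall>n. 0 < \<sigma> n)"

text \<open>
  The infimum over the class stands outside the lower limit.  Membership in the class is an
  asymptotic property, so every procedure can be replaced at any single \<open>n\<close> by one of length
  zero; the infimum over the class at a fixed \<open>n\<close> would therefore vanish.
\<close>

definition minimax_length_liminf ::
    "(nat \<Rightarrow> nat) \<Rightarrow> (nat \<Rightarrow> nat) \<Rightarrow> (nat \<Rightarrow> real) \<Rightarrow> (nat \<Rightarrow> real) \<Rightarrow> real \<Rightarrow> real \<Rightarrow>
     (nat \<Rightarrow> real) \<Rightarrow> ennreal" where
  "minimax_length_liminf d s a \<sigma> \<alpha> \<delta> r =
     (INF (S, U, L)\<in>M_class d s a \<sigma> \<alpha> \<delta>.
        liminf (\<lambda>n. max_length (d n) (s n) (a n) (\<sigma> n) (U n) (L n) / ennreal (r n)))"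

definition TS_length_limsup ::
    "(nat \<Rightarrow> nat) \<Rightarrow> (nat \<Rightarrow> nat) \<Rightarrow> (nat \<Rightarrow> real) \<Rightarrow> (nat \<Rightarrow> real) \<Rightarrow> real \<Rightarrow> real \<Rightarrow> real \<Rightarrow>
     (nat \<Rightarrow> real) \<Rightarrow> ennreal" where
  "TS_length_limsup d s a \<sigma> \<alpha> \<alpha>' \<delta> r =
     limsup (\<lambda>n. max_length (d n) (s n) (a n) (\<sigma> n)
                   (TS_U (d n) (s n) (a n) (\<sigma> n) \<alpha> \<alpha>' \<delta>) (TS_L (d n) (s n) (a n) (\<sigma> n) \<alpha> \<alpha>' \<delta>)
                 / ennreal (r n))"

end

theory Submission
  imports Defs "HOL-Real_Asymp.Real_Asymp"
begin

text \<open>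
  Lower bounds: the coverage factorises over the coordinates, so the individual non-coverage
  probabilities have a bounded sum, and some coordinate \<open>j\<close> covers both \<open>t\<close> and \<open>t + h \<sigma>\<close> with
  an error of order \<open>1 / m\<close> and \<open>1 / s\<close>, respectively.  Here \<open>t = 0\<close>, \<open>m = d\<close> in the first regime
  (every coordinate may vanish) and \<open>t = a\<close>, \<open>m = s\<close> in the second one.  With
  \<open>h = sqrt (2 ln (m / B))\<close> and \<open>B\<close> tending slowly to infinity, the likelihood ratio of the two
  means is at most \<open>exp (h\<^sup>2 / 2) = m / B\<close> on a half line that has probability \<open>1 / 2\<close> under the
  larger mean.  Hence under that mean the interval contains both points with probability at least
  \<open>1 / 2 - o(1)\<close>, and then its length is at least \<open>h \<sigma>\<close>.

  Upper bounds: the critical values are calibrated by Mills' ratio, and the coverage error is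
  controlled by a union bound.
\<close>

subsection \<open>The normal distribution\<close>

text \<open>The growth of B is squeezed from two sides. The error at t, transferred to the larger
  mean, is a constant times \<open>exp (h\<^sup>2 / 2) / m = 1 / B\<close>, so B must diverge;
  \<open>B \<le> ln m\<close> keeps h asymptotic to \<open>sqrt (2 * ln m)\<close>. In the first
  regime B also stays below A, so that h \<sigma> reaches the minimal signal a: this is where the
  upper bound on a / \<sigma> enters. In the second regime t is already an admissible signal and
  increasing it keeps it admissible. The two means do not occur equally often: t may sit on all m
  coordinates at once, t + h \<sigma> on at most s of them. A counting argument therefore has to
  produce one coordinate that is good for both. For the upper bounds the obstacle is that d - s need
  not diverge in the second regime. Estimates at d - s are either valid for every argument above 1
  or hold beyond a bound N fixed before the sequences; when d - s < 2, d is so close to s that a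
  width calibrated at d is still of the order for s.\<close>

abbreviation gauss :: "real \<Rightarrow> real \<Rightarrow> real measure" where
  "gauss \<mu> \<sigma> \<equiv> density lborel (\<lambda>x. ennreal (normal_density \<mu> \<sigma> x))"

definition upper_tail :: "real \<Rightarrow> real" where
  "upper_tail t = measure std_normal_distribution {t..}"

lemma measure_gauss_standardize:
  assumes "0 < \<sigma>" "B \<in> sets borel"
  shows "measure (gauss \<mu> \<sigma>) {x. (x - \<mu>) / \<sigma> \<in> B} = measure std_normal_distribution B"
proof -
  interpret prob_space "gauss \<mu> \<sigma>" by (rule prob_space_normal_density) fact
  have "distributed (gauss \<mu> \<sigma>) lborel (\<lambda>x. x) (normal_density \<mu> \<sigma>)"
    unfolding distributed_def
  proof (intro conjI)
    show "distr (gauss \<mu> \<sigma>) lborel (\<lambda>x. x) = gauss \<mu> \<sigma>"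
      by (rule distr_id2) simp
  qed simp_all
  then have "distributed (gauss \<mu> \<sigma>) lborel (\<lambda>x. (x - \<mu>) / \<sigma>) std_normal_density"
    using normal_standard_normal_convert[OF assms(1), of "\<lambda>x. x" \<mu>] by simp
  then have "distr (gauss \<mu> \<sigma>) lborel (\<lambda>x. (x - \<mu>) / \<sigma>) = std_normal_distribution"
    by (simp add: distributed_def)
  then have "measure std_normal_distribution B =
      measure (distr (gauss \<mu> \<sigma>) lborel (\<lambda>x. (x - \<mu>) / \<sigma>)) B"
    by simp
  also have "\<dots> = measure (gauss \<mu> \<sigma>) {x. (x - \<mu>) / \<sigma> \<in> B}"
    using assms(2) by (subst measure_distr) (auto simp: vimage_def)
  finally show ?thesis by simp
qed

lemma measure_std_normal_uminus:
  assumes "B \<in> sets borel"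
  shows "measure std_normal_distribution {x. - x \<in> B} = measure std_normal_distribution B"
proof -
  interpret prob_space std_normal_distribution by (rule prob_space_normal_density) simp
  have "distr std_normal_distribution lborel (\<lambda>x. x) = std_normal_distribution"
    by (rule distr_id2) simp
  then have "distributed std_normal_distribution lborel (\<lambda>x. x) std_normal_density"
    unfolding distributed_def by simp
  from normal_density_affine[OF this, of "-1" 0]
  have "distr std_normal_distribution lborel (\<lambda>x. - x) = std_normal_distribution"
    by (simp add: distributed_def)
  then have "measure std_normal_distribution B = measure (distr std_normal_distribution lborel uminus) B"
    by simp
  also have "\<dots> = measure std_normal_distribution {x. - x \<in> B}"
    using assms by (subst measure_distr) (auto simp: vimage_def)
  finally show ?thesis by simp
qed

lemma upper_tail_reflect: "measure std_normal_distribution {..- t} = upper_tail t"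
proof -
  have "{x. - x \<in> {t..}} = {..- t}" by auto
  then show ?thesis
    using measure_std_normal_uminus[of "{t..}"] by (simp add: upper_tail_def)
qed

lemma measure_std_normal_singleton: "measure std_normal_distribution {t} = 0"
proof -
  have "emeasure std_normal_distribution {t} =
      (\<integral>\<^sup>+ x. ennreal (std_normal_density x) * indicator {t} x \<partial>lborel)"
    by (rule emeasure_density) auto
  also have "\<dots> = (\<integral>\<^sup>+ x. 0 \<partial>(lborel :: real measure))"
  proof (rule nn_integral_cong_AE)
    show "AE x in lborel. ennreal (std_normal_density x) * indicator {t} x = 0"
      using AE_lborel_singleton[of t] by (rule eventually_mono) simp
  qed
  finally show ?thesis by (simp add: measure_def)
qed

lemma measure_std_normal_greaterThan: "measure std_normal_distribution {t<..} = upper_tail t"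
proof -
  interpret prob_space std_normal_distribution by (rule prob_space_normal_density) simp
  have "{t..} = {t<..} \<union> {t}" by auto
  then show ?thesis
    using finite_measure_Union[of "{t<..}" "{t}"] measure_std_normal_singleton[of t]
    by (simp add: upper_tail_def)
qed

lemma Phi_eq: "Phi t = 1 - upper_tail t"
proof -
  interpret prob_space std_normal_distribution by (rule prob_space_normal_density) simp
  have "{t<..} = space std_normal_distribution - {..t}" by auto
  then show ?thesis
    using prob_compl[of "{..t}"] measure_std_normal_greaterThan[of t] by (simp add: Phi_def cdf_def)
qed

lemma upper_tail_antimono: "t \<le> u \<Longrightarrow> upper_tail u \<le> upper_tail t"
proof -
  interpret prob_space std_normal_distribution by (rule prob_space_normal_density) simp
  assume "t \<le> u"
  then show ?thesis unfolding upper_tail_def by (intro finite_measure_mono) auto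
qed

lemma upper_tail_uminus: "upper_tail (- t) = 1 - upper_tail t"
  using upper_tail_reflect[of "-t"] Phi_eq[of t] by (simp add: Phi_def cdf_def)

lemma Phi_0: "Phi 0 = 1 / 2"
  using upper_tail_uminus[of 0] by (simp add: Phi_eq)

text \<open>\<open>Phi\<close> is continuous because the normal law has no atoms, and it tends to 0
  and 1, so the intermediate value theorem gives a preimage. Existence alone suffices for
  \<open>inv\<close>.\<close>

lemma Phi_Phi_inv:
  assumes "0 < p" "p < 1"
  shows "Phi (Phi_inv p) = p"
proof -
  interpret real_distribution std_normal_distribution by (rule real_dist_normal_dist)
  have cont: "isCont Phi x" for x
    unfolding Phi_def isCont_cdf by (rule measure_std_normal_singleton)
  have "(Phi \<longlongrightarrow> 0) at_bot" "(Phi \<longlongrightarrow> 1) at_top"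
    unfolding Phi_def using cdf_lim_at_bot cdf_lim_at_top_prob by auto
  then have "\<forall>\<^sub>F x in at_bot. Phi x < p" "\<forall>\<^sub>F x in at_top. p < Phi x"
    using assms by (auto simp: order_tendsto_iff)
  then obtain x y where xy: "\<And>z. z \<le> x \<Longrightarrow> Phi z < p" "\<And>z. y \<le> z \<Longrightarrow> p < Phi z"
    unfolding eventually_at_bot_linorder eventually_at_top_linorder by auto
  have "\<exists>z. min x y \<le> z \<and> z \<le> max x y \<and> Phi z = p"
    by (rule IVT) (use xy[of "min x y"] xy(2)[of "max x y"] cont in \<open>auto intro: less_imp_le\<close>)
  then show ?thesis
    unfolding Phi_inv_def by (meson f_inv_into_f rangeI)
qed

lemma Phi_inv_pos:
  assumes "1 / 2 < p" "p < 1"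
  shows "0 < Phi_inv p"
proof (rule ccontr)
  assume "\<not> 0 < Phi_inv p"
  then have "upper_tail 0 \<le> upper_tail (Phi_inv p)" by (intro upper_tail_antimono) simp
  then show False using Phi_Phi_inv[of p] assms Phi_0 by (simp add: Phi_eq)
qed

text \<open>Mills' ratio: on the half line the factor x / t is at least 1, and multiplying the
  density by it gives a function with an explicit primitive.\<close>

lemma upper_tail_le:
  assumes "0 < t"
  shows "upper_tail t \<le> exp (- t\<^sup>2 / 2) / (t * sqrt (2 * pi))"
proof -
  let ?F = "\<lambda>x. - (exp (- x\<^sup>2 / 2) / (t * sqrt (2 * pi)))"
  let ?f = "\<lambda>x. x * exp (- x\<^sup>2 / 2) / (t * sqrt (2 * pi))"
  have "emeasure std_normal_distribution {t..} =
      (\<integral>\<^sup>+ x. ennreal (std_normal_density x) * indicator {t..} x \<partial>lborel)"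
    by (rule emeasure_density) auto
  also have "\<dots> \<le> (\<integral>\<^sup>+ x. ennreal (?f x) * indicator {t..} x \<partial>lborel)"
  proof (rule nn_integral_mono)
    fix x :: real
    show "ennreal (std_normal_density x) * indicator {t..} x \<le> ennreal (?f x) * indicator {t..} x"
    proof (cases "t \<le> x")
      case True
      then have "1 * exp (- x\<^sup>2 / 2) / sqrt (2 * pi) \<le> (x / t) * exp (- x\<^sup>2 / 2) / sqrt (2 * pi)"
        using assms by (intro divide_right_mono mult_right_mono) auto
      then show ?thesis using True assms
        by (auto simp: std_normal_density_def intro!: ennreal_leI)
    qed simp
  qed
  also have "\<dots> = ennreal (0 - ?F t)"
  proof (rule nn_integral_FTC_atLeast[where F = ?F])
    show "?f \<in> borel_measurable borel" by measurable
    show "DERIV ?F x :> ?f x" if "t \<le> x" for x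
    proof -
      have "DERIV (\<lambda>x. exp (- x\<^sup>2 / 2)) x :> - (x * exp (- x\<^sup>2 / 2))"
        by (auto intro!: derivative_eq_intros)
      from DERIV_minus[OF DERIV_cdivide[OF this, of "t * sqrt (2 * pi)"]]
      show ?thesis by simp
    qed
    show "0 \<le> ?f x" if "t \<le> x" for x
      using assms that by auto
    have "((\<lambda>x::real. exp (- x\<^sup>2 / 2)) \<longlongrightarrow> 0) at_top" by real_asymp
    from tendsto_minus[OF tendsto_divide[OF this tendsto_const, of "t * sqrt (2 * pi)"]]
    show "(?F \<longlongrightarrow> 0) at_top" using assms by simp
  qed
  finally show ?thesis
    using assms by (simp add: upper_tail_def measure_def enn2real_leI)
qed

lemma measure_gauss_upper_half:
  assumes "0 < \<sigma>"
  shows "measure (gauss \<mu> \<sigma>) {\<mu><..} = 1 / 2"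
proof -
  have "{x. (x - \<mu>) / \<sigma> \<in> {0<..}} = {\<mu><..}" using assms by (auto simp: field_simps)
  then show ?thesis
    using measure_gauss_standardize[OF assms, of "{0<..}" \<mu>] Phi_0
    by (simp add: measure_std_normal_greaterThan Phi_eq)
qed

text \<open>To the left of its mean, the shifted density exceeds the original one by a factor of at
  most \<open>exp (h\<^sup>2 / 2)\<close>; hence the summand \<open>1 / 2\<close>, which is the source of the factor \<open>1 / 2\<close> in the
  lower bounds.\<close>

lemma measure_gauss_shift_le:
  assumes "0 < \<sigma>" "B \<in> sets borel" "0 \<le> h"
  shows "measure (gauss (\<mu> + h * \<sigma>) \<sigma>) B \<le> 1 / 2 + exp (h\<^sup>2 / 2) * measure (gauss \<mu> \<sigma>) B"
proof -
  let ?\<nu> = "\<mu> + h * \<sigma>"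
  interpret N1: prob_space "gauss \<mu> \<sigma>" by (rule prob_space_normal_density) fact
  interpret N2: prob_space "gauss ?\<nu> \<sigma>" by (rule prob_space_normal_density) fact
  have dens: "normal_density ?\<nu> \<sigma> x \<le> exp (h\<^sup>2 / 2) * normal_density \<mu> \<sigma> x" if "x \<le> ?\<nu>" for x
  proof -
    \<comment> \<open>Completing the square leaves the constant
      \<open>(h * \<sigma>)\<^sup>2\<close> and a linear term that changes sign at the larger mean
      and is nonpositive to its left.\<close>
    have "(x - \<mu>)\<^sup>2 - (x - ?\<nu>)\<^sup>2 = 2 * (h * \<sigma>) * (x - ?\<nu>) + (h * \<sigma>)\<^sup>2"
      by (simp add: power2_eq_square algebra_simps)
    also have "\<dots> \<le> (h * \<sigma>)\<^sup>2"
      using assms that by (simp add: mult_nonneg_nonpos)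
    finally have "- (x - ?\<nu>)\<^sup>2 / (2 * \<sigma>\<^sup>2) \<le> h\<^sup>2 / 2 + - (x - \<mu>)\<^sup>2 / (2 * \<sigma>\<^sup>2)"
      using assms(1) by (simp add: field_simps power_mult_distrib)
    then have "exp (- (x - ?\<nu>)\<^sup>2 / (2 * \<sigma>\<^sup>2)) \<le> exp (h\<^sup>2 / 2) * exp (- (x - \<mu>)\<^sup>2 / (2 * \<sigma>\<^sup>2))"
      by (metis exp_add exp_le_cancel_iff)
    then show ?thesis
      unfolding normal_density_def by (simp add: divide_right_mono)
  qed
  let ?B = "B \<inter> {..?\<nu>}"
  have "emeasure (gauss ?\<nu> \<sigma>) ?B = (\<integral>\<^sup>+ x. ennreal (normal_density ?\<nu> \<sigma> x) * indicator ?B x \<partial>lborel)"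
    using assms by (intro emeasure_density) auto
  also have "\<dots> \<le> (\<integral>\<^sup>+ x. ennreal (exp (h\<^sup>2 / 2)) * (ennreal (normal_density \<mu> \<sigma> x) * indicator B x) \<partial>lborel)"
    by (intro nn_integral_mono)
      (auto simp: indicator_def ennreal_mult'[symmetric] intro!: ennreal_leI dens)
  also have "\<dots> = ennreal (exp (h\<^sup>2 / 2)) * emeasure (gauss \<mu> \<sigma>) B"
    using assms(2) by (subst nn_integral_cmult) (auto simp: emeasure_density)
  finally have "measure (gauss ?\<nu> \<sigma>) ?B \<le> exp (h\<^sup>2 / 2) * measure (gauss \<mu> \<sigma>) B"
    by (simp add: N1.emeasure_eq_measure N2.emeasure_eq_measure ennreal_mult'[symmetric])
  moreover have "measure (gauss ?\<nu> \<sigma>) B \<le> measure (gauss ?\<nu> \<sigma>) (?B \<union> {?\<nu><..})"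
    using assms(2) by (intro N2.finite_measure_mono) auto
  moreover have "\<dots> \<le> measure (gauss ?\<nu> \<sigma>) ?B + measure (gauss ?\<nu> \<sigma>) {?\<nu><..}"
    using assms(2) by (intro measure_Un_le) auto
  ultimately show ?thesis
    using measure_gauss_upper_half[OF assms(1), of ?\<nu>] by linarith
qed

subsection \<open>Coverage and length in the product model\<close>

lemma space_gauss_model: "space (gauss_model d \<theta> \<sigma>) = Rvec d"
  by (simp add: gauss_model_def Rvec_def space_PiM)

lemma prob_space_gauss_model: "0 < \<sigma> \<Longrightarrow> prob_space (gauss_model d \<theta> \<sigma>)"
  unfolding gauss_model_def by (intro prob_space_PiM prob_space_normal_density)

lemma measure_gauss_model_PiE:
  assumes "0 < \<sigma>" "\<And>j. j \<in> {1..d} \<Longrightarrow> B j \<in> sets borel"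
  shows "measure (gauss_model d \<theta> \<sigma>) (Pi\<^sub>E {1..d} B) =
    (\<Prod>j\<in>{1..d}. measure (gauss (\<theta> j) \<sigma>) (B j))"
proof -
  interpret finite_product_prob_space "\<lambda>j. gauss (\<theta> j) \<sigma>" "{1..d}"
    by (intro finite_product_prob_space.intro product_prob_space.intro
        product_prob_space_axioms.intro product_sigma_finite.intro
        finite_product_sigma_finite.intro finite_product_sigma_finite_axioms.intro
        prob_space_imp_sigma_finite prob_space_normal_density) (use assms in auto)
  show ?thesis
    unfolding gauss_model_def using assms by (intro finite_measure_PiM_emb) auto
qed

lemma distr_gauss_model_component:
  assumes "0 < \<sigma>" "j \<in> {1..d}"
  shows "distr (gauss_model d \<theta> \<sigma>) (gauss (\<theta> j) \<sigma>) (\<lambda>x. x j) = gauss (\<theta> j) \<sigma>"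
  unfolding gauss_model_def
  by (rule distr_PiM_component[where M = "\<lambda>j. gauss (\<theta> j) \<sigma>"])
    (use assms in \<open>auto intro: prob_space_normal_density\<close>)

lemma measurable_gauss_model_component:
  "j \<in> {1..d} \<Longrightarrow> (\<lambda>x. x j) \<in> measurable (gauss_model d \<theta> \<sigma>) (gauss (\<theta> j) \<sigma>)"
  unfolding gauss_model_def by (rule measurable_component_singleton)

lemma nn_integral_gauss_model_component:
  assumes "0 < \<sigma>" "j \<in> {1..d}" "f \<in> borel_measurable borel"
  shows "(\<integral>\<^sup>+ x. f (x j) \<partial>gauss_model d \<theta> \<sigma>) = (\<integral>\<^sup>+ y. f y \<partial>gauss (\<theta> j) \<sigma>)"
proof -
  have "(\<integral>\<^sup>+ y. f y \<partial>gauss (\<theta> j) \<sigma>) =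
      (\<integral>\<^sup>+ y. f y \<partial>distr (gauss_model d \<theta> \<sigma>) (gauss (\<theta> j) \<sigma>) (\<lambda>x. x j))"
    by (simp only: distr_gauss_model_component[OF assms(1,2)])
  also have "\<dots> = (\<integral>\<^sup>+ x. f (x j) \<partial>gauss_model d \<theta> \<sigma>)"
    using assms by (intro nn_integral_distr measurable_gauss_model_component) auto
  finally show ?thesis by simp
qed

lemma measure_gauss_model_component:
  assumes "0 < \<sigma>" "j \<in> {1..d}" "B \<in> sets borel"
  shows "measure (gauss_model d \<theta> \<sigma>) {x \<in> Rvec d. x j \<in> B} = measure (gauss (\<theta> j) \<sigma>) B"
proof -
  have "measure (gauss (\<theta> j) \<sigma>) B =
      measure (distr (gauss_model d \<theta> \<sigma>) (gauss (\<theta> j) \<sigma>) (\<lambda>x. x j)) B"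
    by (simp only: distr_gauss_model_component[OF assms(1,2)])
  also have "\<dots> = measure (gauss_model d \<theta> \<sigma>) ((\<lambda>x. x j) -` B \<inter> space (gauss_model d \<theta> \<sigma>))"
    using assms by (intro measure_distr measurable_gauss_model_component) auto
  also have "(\<lambda>x. x j) -` B \<inter> space (gauss_model d \<theta> \<sigma>) = {x \<in> Rvec d. x j \<in> B}"
    by (auto simp: space_gauss_model)
  finally show ?thesis by simp
qed

lemma sets_covering [measurable]:
  fixes l u :: "real \<Rightarrow> real"
  assumes [measurable]: "l \<in> borel_measurable borel" "u \<in> borel_measurable borel"
  shows "{y. t \<in> {l y..u y}} \<in> sets borel"
  by simp

text \<open>Since the intervals collapse to \<open>{0}\<close> off the selected set, the selector plays no role
  for the coverage.\<close>

lemma coverage_eq_prod: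
  assumes \<sigma>: "0 < \<sigma>" and CI: "CI_class d S U L" and \<theta>: "\<theta> \<in> Rvec d"
    and meas: "\<And>j. j \<in> {1..d} \<Longrightarrow> l j \<in> borel_measurable borel"
      "\<And>j. j \<in> {1..d} \<Longrightarrow> u j \<in> borel_measurable borel"
    and L: "\<And>x j. x \<in> Rvec d \<Longrightarrow> j \<in> {1..d} \<Longrightarrow> L x j = l j (x j)"
    and U: "\<And>x j. x \<in> Rvec d \<Longrightarrow> j \<in> {1..d} \<Longrightarrow> U x j = u j (x j)"
  shows "measure (gauss_model d \<theta> \<sigma>) {x \<in> Rvec d. \<theta> \<in> conf_set d S U L x} =
    (\<Prod>j\<in>{1..d}. measure (gauss (\<theta> j) \<sigma>) {y. \<theta> j \<in> {l j y..u j y}})"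
proof -
  have iff: "\<theta> \<in> conf_set d S U L x \<longleftrightarrow> (\<forall>j\<in>{1..d}. \<theta> j \<in> {L x j..U x j})"
    if x: "x \<in> Rvec d" for x
  proof -
    have S: "S x \<subseteq> {1..d}" and Z: "\<forall>j\<in>{1..d} - S x. L x j = 0 \<and> U x j = 0"
      using CI x by (auto simp: CI_class_def)
    have off: "\<theta> j \<in> {L x j..U x j} \<longleftrightarrow> \<theta> j = 0" if "j \<in> {1..d} - S x" for j
      using Z that by auto
    have "\<theta> \<in> conf_set d S U L x \<longleftrightarrow>
        (\<forall>j\<in>{1..d} - S x. \<theta> j \<in> {L x j..U x j}) \<and> (\<forall>j\<in>S x. \<theta> j \<in> {L x j..U x j})"
      unfolding conf_set_def using \<theta> off by blast
    also have "\<dots> \<longleftrightarrow> (\<forall>j\<in>{1..d}. \<theta> j \<in> {L x j..U x j})"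
      using S by blast
    finally show ?thesis .
  qed
  have "{x \<in> Rvec d. \<theta> \<in> conf_set d S U L x} = Pi\<^sub>E {1..d} (\<lambda>j. {y. \<theta> j \<in> {l j y..u j y}})"
  proof (intro set_eqI iffI)
    fix x assume "x \<in> {x \<in> Rvec d. \<theta> \<in> conf_set d S U L x}"
    then have "x \<in> Rvec d" "\<forall>j\<in>{1..d}. \<theta> j \<in> {L x j..U x j}" using iff by auto
    then show "x \<in> Pi\<^sub>E {1..d} (\<lambda>j. {y. \<theta> j \<in> {l j y..u j y}})"
      using L U by (auto simp: Rvec_def PiE_iff)
  next
    fix x assume x: "x \<in> Pi\<^sub>E {1..d} (\<lambda>j. {y. \<theta> j \<in> {l j y..u j y}})"
    then have "x \<in> Rvec d" by (auto simp: Rvec_def PiE_iff)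
    moreover from this have "\<forall>j\<in>{1..d}. \<theta> j \<in> {L x j..U x j}"
      using L U x by (auto simp: PiE_iff)
    ultimately show "x \<in> {x \<in> Rvec d. \<theta> \<in> conf_set d S U L x}"
      using iff by auto
  qed
  then show ?thesis
    using measure_gauss_model_PiE[OF \<sigma>, of d "\<lambda>j. {y. \<theta> j \<in> {l j y..u j y}}" \<theta>] meas
    by (simp add: sets_covering del: atLeastAtMost_iff)
qed

section \<open>From joint coverage to the length of a single interval\<close>

text \<open>Termwise \<open>1 - x \<le> - ln x\<close>. Applied to the coverage probabilities of the
  coordinates, it bounds the total miss probability by a constant that does not depend on the
  dimension.\<close>

lemma sum_one_minus_le_of_prod_ge:
  fixes f :: "'a \<Rightarrow> real"
  assumes "finite A" "\<And>i. i \<in> A \<Longrightarrow> 0 \<le> f i" "0 < c" "c \<le> prod f A"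
  shows "(\<Sum>i\<in>A. 1 - f i) \<le> - ln c"
proof -
  have pos: "0 < f i" if "i \<in> A" for i
  proof -
    have "f i \<noteq> 0"
    proof
      assume "f i = 0"
      then have "prod f A = 0" using assms(1) that by (intro prod_zero) auto
      then show False using assms(3,4) by linarith
    qed
    then show ?thesis using assms(2)[OF that] by simp
  qed
  have "(\<Sum>i\<in>A. 1 - f i) \<le> (\<Sum>i\<in>A. - ln (f i))"
  proof (rule sum_mono)
    fix i assume "i \<in> A"
    then show "1 - f i \<le> - ln (f i)" using ln_le_minus_one[OF pos[of i]] by simp
  qed
  also have "\<dots> = - ln (prod f A)"
    using assms(1) pos by (subst ln_prod) (force simp: sum_negf)+
  also have "\<dots> \<le> - ln c"
    using assms(3,4) by simp
  finally show ?thesis .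
qed

text \<open>By Markov's inequality at least half of T is good for f. The sums of g are controlled
  only on sets of at most s elements, so g is tested on such a subset of the good indices. Each
  factor 2 pays for a loss of one half.\<close>

lemma exists_small_in_two_sums:
  fixes f g :: "'a \<Rightarrow> real"
  assumes T: "finite T" "card T = m" and s: "0 < s" "s \<le> m" and K: "0 < K"
    and f: "\<And>j. j \<in> T \<Longrightarrow> 0 \<le> f j" "sum f T \<le> K"
    and g: "\<And>T'. T' \<subseteq> T \<Longrightarrow> card T' \<le> s \<Longrightarrow> sum g T' \<le> K"
  shows "\<exists>j\<in>T. f j \<le> 2 * K / m \<and> g j \<le> 2 * K / s"
proof (rule ccontr)
  assume contra: "\<not> ?thesis"
  define G where "G = {j \<in> T. f j \<le> 2 * K / m}"
  have G: "G \<subseteq> T" "finite G" using T(1) by (auto simp: G_def)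
  have "card (T - G) * (2 * K / m) \<le> sum f (T - G)"
    by (rule sum_bounded_below) (auto simp: G_def)
  also have "\<dots> \<le> sum f T"
    using T(1) f(1) by (intro sum_mono2) auto
  also have "\<dots> \<le> K" by (rule f(2))
  finally have "2 * real (card (T - G)) \<le> m"
    using K s by (simp add: field_simps)
  moreover have "card (T - G) = card T - card G" "card G \<le> card T"
    using G T(1) by (auto simp: card_Diff_subset card_mono)
  ultimately have cG: "m \<le> 2 * card G"
    using T(2) by linarith
  \<comment> \<open>There may be fewer than s good indices when m is close to s. Since their number
    is at least m / 2, \<open>T'\<close> still has at least s / 2 elements.\<close>
  obtain T' where T': "T' \<subseteq> G" "card T' = min s (card G)"
    by (meson min.cobounded2 obtain_subset_with_card_n)
  have c: "s \<le> 2 * card T'" "card T' > 0"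
    using T'(2) cG s by (auto simp: min_def)
  have "K \<le> card T' * (2 * K / s)"
  proof -
    have "real s * K \<le> (2 * real (card T')) * K"
      using c(1) K by (intro mult_right_mono) linarith+
    then show ?thesis using s(1) by (simp add: pos_le_divide_eq mult_ac)
  qed
  also have "\<dots> < sum g T'"
  proof -
    have "finite T'" "T' \<noteq> {}" using c(2) unfolding card_gt_0_iff by simp_all
    moreover have "2 * K / s < g j" if "j \<in> T'" for j
      using contra T'(1) that unfolding G_def by force
    ultimately have "(\<Sum>j\<in>T'. 2 * K / s) < sum g T'"
      by (rule sum_strict_mono)
    then show ?thesis by simp
  qed
  also have "\<dots> \<le> K"
    using T' G by (intro g) auto
  finally show False by simp
qed

text \<open>The base vector, equal to t on all of T, controls the misses of t; vectors equal to t +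
  h \<sigma> on at most s coordinates control the misses of the larger mean. An interval that
  contains both values has length at least h \<sigma>.\<close>

lemma max_length_ge:
  assumes \<sigma>: "0 < \<sigma>" and CI: "CI_class d S U L" and s: "0 < s" "s \<le> m"
    and c: "0 < c" "c < 1" "ereal c \<le> min_coverage d s a \<sigma> S U L"
    and T: "T \<subseteq> {1..d}" "card T = m"
    and base: "(\<lambda>j\<in>{1..d}. if j \<in> T then t else 0) \<in> Theta d s a"
    and h: "0 \<le> h" "a \<le> \<bar>t + h * \<sigma>\<bar>"
  shows "ennreal (h * \<sigma> * (1 / 2 - 2 * (- ln c) / s - exp (h\<^sup>2 / 2) * (2 * (- ln c) / m)))
    \<le> max_length d s a \<sigma> U L"
proof -
  define t' where "t' = t + h * \<sigma>"
  define K where "K = - ln c"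
  have K: "0 < K" using c by (simp add: K_def)
  have "\<forall>j. \<exists>l. j \<in> {1..d} \<longrightarrow> l \<in> borel_measurable borel \<and> (\<forall>x\<in>Rvec d. L x j = l (x j))"
    "\<forall>j. \<exists>u. j \<in> {1..d} \<longrightarrow> u \<in> borel_measurable borel \<and> (\<forall>x\<in>Rvec d. U x j = u (x j))"
    using CI unfolding CI_class_def by blast+
  then obtain l u where lu:
    "\<And>j. j \<in> {1..d} \<Longrightarrow> l j \<in> borel_measurable borel"
    "\<And>j. j \<in> {1..d} \<Longrightarrow> u j \<in> borel_measurable borel"
    "\<And>x j. x \<in> Rvec d \<Longrightarrow> j \<in> {1..d} \<Longrightarrow> L x j = l j (x j)"
    "\<And>x j. x \<in> Rvec d \<Longrightarrow> j \<in> {1..d} \<Longrightarrow> U x j = u j (x j)"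
    by metis
  \<comment> \<open>The endpoints for j are functions of the j-th observation, so this probability
    depends on the j-th mean alone. Hence bounds obtained from different parameter vectors can be
    combined at the same j.\<close>
  define p where "p = (\<lambda>j v. measure (gauss v \<sigma>) {y. v \<in> {l j y..u j y}})"
  have prob: "prob_space (gauss v \<sigma>)" for v using \<sigma> by (rule prob_space_normal_density)
  have p01: "0 \<le> p j v" "p j v \<le> 1" for j v
    unfolding p_def using prob_space.prob_le_1[OF prob] by auto
  have sum_le: "(\<Sum>j\<in>A. 1 - p j (\<theta> j)) \<le> K" if "\<theta> \<in> Theta d s a" "A \<subseteq> {1..d}" for \<theta> A
  proof -
    have "min_coverage d s a \<sigma> S U L
        \<le> ereal (measure (gauss_model d \<theta> \<sigma>) {x \<in> Rvec d. \<theta> \<in> conf_set d S U L x})"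
      unfolding min_coverage_def by (rule INF_lower) fact
    also have "measure (gauss_model d \<theta> \<sigma>) {x \<in> Rvec d. \<theta> \<in> conf_set d S U L x} =
        (\<Prod>j\<in>{1..d}. p j (\<theta> j))"
      unfolding p_def by (rule coverage_eq_prod) (use \<sigma> CI that lu in \<open>auto simp: Theta_def\<close>)
    finally have "c \<le> (\<Prod>j\<in>{1..d}. p j (\<theta> j))"
      using c(3) by (meson ereal_less_eq(3) order_trans)
    then have "(\<Sum>j\<in>{1..d}. 1 - p j (\<theta> j)) \<le> K"
      unfolding K_def using p01 c by (intro sum_one_minus_le_of_prod_ge) auto
    moreover have "(\<Sum>j\<in>A. 1 - p j (\<theta> j)) \<le> (\<Sum>j\<in>{1..d}. 1 - p j (\<theta> j))"
      using that(2) p01 by (intro sum_mono2) auto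
    ultimately show ?thesis by simp
  qed
  have shifted: "(\<lambda>j\<in>{1..d}. if j \<in> T' then t' else 0) \<in> Theta d s a"
    if "T' \<subseteq> {1..d}" "card T' \<le> s" for T'
  proof -
    have "finite T'" using that(1) finite_subset by blast
    then have "card {j \<in> {1..d}. (\<lambda>j\<in>{1..d}. if j \<in> T' then t' else 0) j \<noteq> 0} \<le> card T'"
      by (intro card_mono) (auto split: if_splits)
    then show ?thesis
      using that h by (auto simp: Theta_def Rvec_def l0_norm_def t'_def)
  qed
  have "\<exists>j\<in>T. 1 - p j t \<le> 2 * K / m \<and> 1 - p j t' \<le> 2 * K / s"
  proof (rule exists_small_in_two_sums[OF _ T(2) s K])
    show "finite T" using T(1) finite_subset by blast
    have "(\<Sum>j\<in>T. 1 - p j t) = (\<Sum>j\<in>T. 1 - p j ((\<lambda>j\<in>{1..d}. if j \<in> T then t else 0) j))"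
      using T(1) by (intro sum.cong) auto
    then show "(\<Sum>j\<in>T. 1 - p j t) \<le> K" using sum_le[OF base T(1)] by simp
    show "(\<Sum>j\<in>T'. 1 - p j t') \<le> K" if "T' \<subseteq> T" "card T' \<le> s" for T'
    proof -
      have "T' \<subseteq> {1..d}" using that T(1) by blast
      moreover from this have "(\<Sum>j\<in>T'. 1 - p j t') =
          (\<Sum>j\<in>T'. 1 - p j ((\<lambda>j\<in>{1..d}. if j \<in> T' then t' else 0) j))"
        by (intro sum.cong) auto
      ultimately show ?thesis using sum_le[OF shifted, of T' T'] that(2) by simp
    qed
  qed (use p01 in auto)
  then obtain j where j: "j \<in> {1..d}" "1 - p j t \<le> 2 * K / m" "1 - p j t' \<le> 2 * K / s"
    using T(1) by blast
  note [measurable] = lu(1,2)[OF j(1)]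
  interpret N: prob_space "gauss t' \<sigma>" by (rule prob)
  define E E' where "E = {y. t \<in> {l j y..u j y}}" and "E' = {y. t' \<in> {l j y..u j y}}"
  have EE [measurable]: "E \<in> sets borel" "E' \<in> sets borel"
    unfolding E_def E'_def by measurable
  \<comment> \<open>A miss of t is rare under mean t, but the length is evaluated under mean
    \<open>t'\<close>; the shift inequality moves the bound from one to the other.\<close>
  have "N.prob (- E) \<le> 1 / 2 + exp (h\<^sup>2 / 2) * measure (gauss t \<sigma>) (- E)"
    unfolding t'_def using h EE by (intro measure_gauss_shift_le \<sigma>) (auto simp: borel_comp)
  also have "measure (gauss t \<sigma>) (- E) = 1 - p j t"
    using prob_space.prob_compl[OF prob, of E t] EE by (simp add: p_def E_def Compl_eq_Diff_UNIV)
  also have "1 / 2 + exp (h\<^sup>2 / 2) * (1 - p j t) \<le> 1 / 2 + exp (h\<^sup>2 / 2) * (2 * K / m)"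
    using j(2) by (intro add_left_mono mult_left_mono) auto
  finally have A: "N.prob (- E) \<le> 1 / 2 + exp (h\<^sup>2 / 2) * (2 * K / m)" .
  have B: "N.prob (- E') \<le> 2 * K / s"
    using j(3) N.prob_compl[of E'] EE by (simp add: p_def E'_def Compl_eq_Diff_UNIV)
  have "1 - N.prob (E \<inter> E') = N.prob (- (E \<inter> E'))"
    using N.prob_compl[of "E \<inter> E'"] EE by (simp add: Compl_eq_Diff_UNIV)
  also have "\<dots> \<le> N.prob (- E) + N.prob (- E')"
    unfolding Compl_Int using EE by (intro measure_Un_le) (auto simp: borel_comp)
  finally have C: "1 / 2 - 2 * K / s - exp (h\<^sup>2 / 2) * (2 * K / m) \<le> N.prob (E \<inter> E')"
    using A B by linarith
  \<comment> \<open>The worst-case length is bounded from below at a vector that carries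
    \<open>t'\<close> in position j and 0 elsewhere, which is admissible since s is
    positive.\<close>
  define \<theta> where "\<theta> = (\<lambda>i\<in>{1..d}. if i \<in> {j} then t' else 0)"
  have \<theta>: "\<theta> \<in> Theta d s a" "\<theta> j = t'"
    unfolding \<theta>_def using shifted[of "{j}"] j(1) s by auto
  have "ennreal (h * \<sigma> * (1 / 2 - 2 * K / s - exp (h\<^sup>2 / 2) * (2 * K / m)))
      \<le> ennreal (h * \<sigma> * N.prob (E \<inter> E'))"
    using C h \<sigma> by (intro ennreal_leI mult_left_mono) auto
  also have "\<dots> = ennreal (h * \<sigma>) * emeasure (gauss t' \<sigma>) (E \<inter> E')"
    using h \<sigma> by (simp add: N.emeasure_eq_measure ennreal_mult')
  also have "\<dots> = (\<integral>\<^sup>+ y. ennreal (h * \<sigma>) * indicator (E \<inter> E') y \<partial>gauss t' \<sigma>)"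
    using EE by (intro nn_integral_cmult_indicator[symmetric]) auto
  also have "\<dots> \<le> (\<integral>\<^sup>+ y. ennreal (u j y - l j y) \<partial>gauss t' \<sigma>)"
    by (intro nn_integral_mono)
      (auto simp: indicator_def E_def E'_def t'_def intro!: ennreal_leI)
  also have "\<dots> = (\<integral>\<^sup>+ x. ennreal (u j (x j) - l j (x j)) \<partial>gauss_model d \<theta> \<sigma>)"
    unfolding \<theta>(2)[symmetric]
    by (rule nn_integral_gauss_model_component[symmetric]) (use \<sigma> j in auto)
  also have "\<dots> = (\<integral>\<^sup>+ x. ennreal (U x j - L x j) \<partial>gauss_model d \<theta> \<sigma>)"
    using lu j(1) by (intro nn_integral_cong) (auto simp: space_gauss_model)
  also have "\<dots> \<le> max_length d s a \<sigma> U L"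
    unfolding max_length_def by (intro SUP_upper2[OF j(1)] SUP_upper2[OF \<theta>(1)]) auto
  finally show ?thesis by (simp add: K_def)
qed

subsection \<open>Asymptotics of the critical values\<close>

text \<open>Approximates the standard normal quantile with upper tail
  \<open>\<beta> / (\<kappa> * x)\<close>. All logarithmic critical values of the procedure are
  instances, with \<kappa> equal to 2 or 4 and x one of s, d and d - s.\<close>

definition quantile_bound :: "real \<Rightarrow> real \<Rightarrow> real \<Rightarrow> real" where
  "quantile_bound \<kappa> \<beta> x = sqrt (2 * ln (\<kappa> * x / (\<beta> * C_const (2 * x) \<beta>)))"

text \<open>Isolates two positive constants, the coefficients of x outside and inside the inner
  logarithm. In this form the asymptotic facts below are within reach of
  \<open>real_asymp\<close>.\<close>

lemma quantile_bound_eq: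
  "quantile_bound \<kappa> \<beta> x = sqrt (2 * ln (\<kappa> / (2 * \<beta>) * x / sqrt (pi * ln (2 / \<beta> * x))))"
  by (simp add: quantile_bound_def C_const_def mult_ac)

lemma filterlim_quantile_bound:
  assumes "0 < \<beta>" "0 < \<kappa>"
  shows "filterlim (quantile_bound \<kappa> \<beta>) at_top at_top"
proof -
  have "filterlim (\<lambda>x::real. sqrt (2 * ln (c * x / sqrt (pi * ln (b * x))))) at_top at_top"
    if "0 < c" "0 < b" for b c :: real
    using that by real_asymp
  from this[of "\<kappa> / (2 * \<beta>)" "2 / \<beta>"] show ?thesis
    unfolding quantile_bound_eq[abs_def] using assms by simp
qed

lemma quantile_bound_le:
  assumes "0 < \<beta>" "0 < \<kappa>" and k: "filterlim k at_top sequentially"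
  shows "\<forall>\<^sub>F n in sequentially.
    quantile_bound \<kappa> \<beta> (real (k n)) \<le> sqrt (2 * ln (\<kappa> / \<beta> * real (k n)))"
proof -
  have "\<forall>\<^sub>F x::real in at_top. sqrt (2 * ln (c * x / sqrt (pi * ln (b * x)))) \<le> sqrt (2 * ln (2 * c * x))"
    if "0 < c" "0 < b" for b c :: real
    using that by real_asymp
  from this[of "\<kappa> / (2 * \<beta>)" "2 / \<beta>"]
  have "\<forall>\<^sub>F x in at_top. quantile_bound \<kappa> \<beta> x \<le> sqrt (2 * ln (\<kappa> / \<beta> * x))"
    unfolding quantile_bound_eq using assms by simp
  then show ?thesis
    by (rule eventually_compose_filterlim) (intro filterlim_compose[OF filterlim_real_sequentially] k)
qed

text \<open>The constant \<open>C_const\<close> is chosen such that it cancels the Mills ratio \<open>1 / t\<close>.\<close>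

lemma upper_tail_quantile_bound:
  assumes "0 < \<beta>" "0 < \<kappa>" "\<beta> / \<kappa> < \<eta>"
  shows "\<forall>\<^sub>F x in at_top. x * upper_tail (quantile_bound \<kappa> \<beta> x) \<le> \<eta>"
proof -
  \<comment> \<open>\<open>C_const\<close> is \<open>sqrt (2 * pi)\<close> times the numerator, and
    the denominator is the critical value itself. After insertion into Mills' bound only \<beta> /
    \<kappa> remains in the limit; the strict gap to \<eta> absorbs the error.\<close>
  have "((\<lambda>x::real. sqrt (2 * ln (b * x)) / sqrt (2 * ln (c * x / sqrt (pi * ln (b * x))))) \<longlongrightarrow> 1) at_top"
    if "0 < c" "0 < b" for b c :: real
    using that by real_asymp
  from this[of "\<kappa> / (2 * \<beta>)" "2 / \<beta>"]
  have "((\<lambda>x::real. sqrt (2 * ln (2 * x / \<beta>)) / quantile_bound \<kappa> \<beta> x) \<longlongrightarrow> 1) at_top"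
    unfolding quantile_bound_eq using assms by simp
  from tendsto_mult[OF tendsto_const[of "\<beta> / \<kappa>"] this]
  have lim: "((\<lambda>x. \<beta> / \<kappa> * (sqrt (2 * ln (2 * x / \<beta>)) / quantile_bound \<kappa> \<beta> x)) \<longlongrightarrow> \<beta> / \<kappa>) at_top"
    by simp
  have C: "C_const (2 * x) \<beta> = sqrt (2 * pi) * sqrt (2 * ln (2 * x / \<beta>))" for x
    by (simp add: C_const_def real_sqrt_mult)
  have "\<forall>\<^sub>F x in at_top. \<beta> / \<kappa> * (C_const (2 * x) \<beta> / (sqrt (2 * pi) * quantile_bound \<kappa> \<beta> x)) < \<eta>"
    using order_tendstoD(2)[OF lim assms(3)] by (simp add: C)
  moreover have "\<forall>\<^sub>F x in at_top. 0 < quantile_bound \<kappa> \<beta> x"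
    using filterlim_quantile_bound[OF assms(1,2)] unfolding filterlim_at_top_dense by blast
  moreover have "\<forall>\<^sub>F x in at_top. 0 < C_const (2 * x) \<beta>"
    unfolding C_const_def using assms by real_asymp
  moreover have "\<forall>\<^sub>F x::real in at_top. 0 < x" by (rule eventually_gt_at_top)
  ultimately show ?thesis
  proof eventually_elim
    case (elim x)
    let ?t = "quantile_bound \<kappa> \<beta> x"
    have pos: "0 < \<kappa> * x / (\<beta> * C_const (2 * x) \<beta>)"
      using elim assms by simp
    \<comment> \<open>\<open>sqrt\<close> is an odd function here, so positivity of the critical
      value guarantees a nonnegative argument and makes squaring exact.\<close>
    have "?t\<^sup>2 = 2 * ln (\<kappa> * x / (\<beta> * C_const (2 * x) \<beta>))"
      using elim(2) unfolding quantile_bound_def by simp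
    then have "exp (- ?t\<^sup>2 / 2) = \<beta> * C_const (2 * x) \<beta> / (\<kappa> * x)"
      using pos by (simp add: exp_minus)
    then have "x * upper_tail ?t \<le> x * (\<beta> * C_const (2 * x) \<beta> / (\<kappa> * x) / (?t * sqrt (2 * pi)))"
      using upper_tail_le[OF elim(2)] elim(4) by (intro mult_left_mono) auto
    also have "\<dots> = \<beta> / \<kappa> * (C_const (2 * x) \<beta> / (sqrt (2 * pi) * ?t))"
      using elim(4) by (simp add: mult_ac)
    finally show ?case using elim(1) by simp
  qed
qed

text \<open>A constant factor and a constant shift inside the logarithm are invisible to first
  order. The shift serves the case where d exceeds s by less than 2.\<close>

lemma sqrt_ln_affine_ratio:
  fixes c b :: real
  assumes "0 < c" "0 \<le> b"
  shows "((\<lambda>x::real. sqrt (2 * ln (c * (x + b))) / sqrt (2 * ln x)) \<longlongrightarrow> 1) at_top"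
  using assms by real_asymp

text \<open>The two logarithms differ by order ln ln x, hence their square roots by order ln ln x /
  sqrt (ln x), which tends to 0 and falls below any fixed c.\<close>

lemma sqrt_ln_gap:
  assumes "0 < \<beta>" "0 < c"
  shows "\<forall>\<^sub>F x in at_top. sqrt (2 * ln (2 * x)) < c + quantile_bound 2 \<beta> x"
proof -
  have "((\<lambda>x::real. sqrt (2 * ln (2 * x)) - sqrt (2 * ln (k * x / sqrt (pi * ln (b * x))))) \<longlongrightarrow> 0) at_top"
    if "0 < k" "0 < b" for b k :: real
    using that by real_asymp
  from this[of "1 / \<beta>" "2 / \<beta>"]
  have "((\<lambda>x. sqrt (2 * ln (2 * x)) - quantile_bound 2 \<beta> x) \<longlongrightarrow> 0) at_top"
    unfolding quantile_bound_eq using assms by simp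
  from order_tendstoD(2)[OF this assms(2)] show ?thesis
    by (rule eventually_mono) linarith
qed

text \<open>The logarithm of \<open>C_const\<close> contributes the term - ln (ln x), and \<kappa> /
  \<beta> determines how large C must be. The bound holds for every x above 1, so it can be used at
  d - s even if that stays bounded; \<beta> \<le> 2 makes the inner logarithm at least ln x.\<close>

lemma quantile_bound_le_loglog:
  assumes "0 < \<beta>" "\<beta> \<le> 2" "1 < x" "2 * ln (\<kappa> / \<beta>) \<le> C" "0 < \<kappa>"
  shows "quantile_bound \<kappa> \<beta> x \<le> sqrt (2 * ln x - ln (ln x) + C)"
proof -
  have l: "0 < ln x" "ln x \<le> ln (2 * x / \<beta>)"
    using assms by (auto simp: field_simps)
  have "ln (\<kappa> * x / (\<beta> * C_const (2 * x) \<beta>)) =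
      ln (\<kappa> / \<beta>) + ln x - ln (2 * sqrt (pi * ln (2 * x / \<beta>)))"
  proof -
    have e: "\<kappa> * x / (\<beta> * C_const (2 * x) \<beta>) = \<kappa> / \<beta> * x / (2 * sqrt (pi * ln (2 * x / \<beta>)))"
      by (simp add: C_const_def)
    have D: "0 < 2 * sqrt (pi * ln (2 * x / \<beta>))" using l by simp
    have "ln (k * x / D) = ln k + ln x - ln D" if "0 < k" "0 < D" for k D
      using that assms(3) by (simp add: ln_mult ln_div)
    from this[OF _ D, of "\<kappa> / \<beta>"] show ?thesis
      unfolding e using assms by simp
  qed
  also have "\<dots> \<le> ln (\<kappa> / \<beta>) + ln x - ln (sqrt (ln x))"
  proof -
    have "sqrt (ln x) \<le> sqrt (pi * ln (2 * x / \<beta>))"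
    proof -
      have "1 * ln x \<le> pi * ln (2 * x / \<beta>)"
        using l pi_gt3 by (intro mult_mono) auto
      then show ?thesis by simp
    qed
    then have "sqrt (ln x) \<le> 2 * sqrt (pi * ln (2 * x / \<beta>))"
      using l(1) by (smt (verit) real_sqrt_gt_zero)
    then show ?thesis using l by (simp add: ln_mono)
  qed
  also have "\<dots> = ln (\<kappa> / \<beta>) + ln x - ln (ln x) / 2"
    using l by (simp add: ln_sqrt)
  finally show ?thesis
    unfolding quantile_bound_def using assms(4) by (intro real_sqrt_le_mono) linarith
qed

subsection \<open>Lower bounds\<close>

lemma liminf_max_length_ge:
  fixes d s m :: "nat \<Rightarrow> nat" and B t :: "nat \<Rightarrow> real"
  assumes M: "(S, U, L) \<in> M_class d s a \<sigma> \<alpha> \<delta>" and \<alpha>: "0 < \<alpha>" "\<alpha> < 1" and \<sigma>: "\<And>n. 0 < \<sigma> n"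
    and lim: "filterlim m at_top sequentially" "filterlim s at_top sequentially"
      "filterlim B at_top sequentially"
    and ev: "\<forall>\<^sub>F n in sequentially. s n \<le> m n" "\<forall>\<^sub>F n in sequentially. B n \<le> ln (m n)"
      "\<forall>\<^sub>F n in sequentially. a n \<le> \<bar>t n + sqrt (2 * ln (m n / B n)) * \<sigma> n\<bar>"
      "\<forall>\<^sub>F n in sequentially. \<exists>T. T \<subseteq> {1..d n} \<and> card T = m n \<and>
        (\<lambda>j\<in>{1..d n}. if j \<in> T then t n else 0) \<in> Theta (d n) (s n) (a n)"
  shows "1 \<le> liminf (\<lambda>n. max_length (d n) (s n) (a n) (\<sigma> n) (U n) (L n)
    / ennreal (\<sigma> n * sqrt (2 * ln (m n)) / 2))"
proof -
  \<comment> \<open>A value strictly below 1 - \<alpha>, so that the asymptotic coverage requirement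
    becomes an actual lower bound for all large n.\<close>
  define c where "c = (1 - \<alpha>) / 2"
  have c: "0 < c" "c < 1" "c < 1 - \<alpha>" using \<alpha> by (auto simp: c_def)
  define K where "K = - ln c"
  define q where "q = (\<lambda>n. sqrt (2 * ln (m n / B n)) / sqrt (2 * ln (m n)))"
  \<comment> \<open>The bound of \<open>max_length_ge\<close> after division by the normalising
    rate. The factor 2 comes from the 1 / 2 in that rate and cancels the limiting probability 1 /
    2.\<close>
  define g where "g = (\<lambda>n. q n * (2 * (1 / 2 - 2 * K / s n - 2 * K / B n)))"
  have m: "filterlim (\<lambda>n. real (m n)) at_top sequentially"
    using lim(1) by (rule filterlim_compose[OF filterlim_real_sequentially])
  have s: "filterlim (\<lambda>n. real (s n)) at_top sequentially"
    using lim(2) by (rule filterlim_compose[OF filterlim_real_sequentially])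
  have m2: "\<forall>\<^sub>F n in sequentially. 3 \<le> real (m n)"
    using m unfolding filterlim_at_top by (rule spec)
  have B1: "\<forall>\<^sub>F n in sequentially. 1 \<le> B n"
    using lim(3) unfolding filterlim_at_top by (rule spec)
  have s1: "\<forall>\<^sub>F n in sequentially. 1 \<le> s n"
    using lim(2) unfolding filterlim_at_top by (rule spec)
  \<comment> \<open>The lower comparison replaces B by its upper bound ln m, the upper one replaces
    it by 1.\<close>
  have "q \<longlonglongrightarrow> 1"
  proof (rule tendsto_sandwich)
    have "((\<lambda>x::real. sqrt (2 * ln (x / ln x)) / sqrt (2 * ln x)) \<longlongrightarrow> 1) at_top"
      by real_asymp
    from filterlim_compose[OF this m]
    show "(\<lambda>n. sqrt (2 * ln (real (m n) / ln (m n))) / sqrt (2 * ln (m n))) \<longlonglongrightarrow> 1" .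
    show "\<forall>\<^sub>F n in sequentially. sqrt (2 * ln (real (m n) / ln (m n))) / sqrt (2 * ln (m n)) \<le> q n"
      using m2 B1 ev(2)
    proof eventually_elim
      case (elim n)
      have "real (m n) / ln (m n) \<le> m n / B n"
        using elim by (intro divide_left_mono) auto
      moreover have "0 < real (m n) / ln (m n)" using elim by simp
      ultimately show ?case unfolding q_def
        using elim by (intro divide_right_mono real_sqrt_le_mono mult_left_mono ln_mono) auto
    qed
    show "\<forall>\<^sub>F n in sequentially. q n \<le> 1"
      using m2 B1
    proof eventually_elim
      case (elim n)
      have "real (m n) / B n \<le> m n / 1"
        using elim by (intro divide_left_mono) auto
      then have "ln (m n / B n) \<le> ln (m n)"
        using elim by (intro ln_mono) auto
      then show ?case unfolding q_def using elim by (simp add: divide_le_eq)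
    qed
  qed simp
  moreover have "(\<lambda>n. 2 * K / s n) \<longlonglongrightarrow> 0" "(\<lambda>n. 2 * K / B n) \<longlonglongrightarrow> 0"
    using s lim(3) by (auto intro: real_tendsto_divide_at_top)
  ultimately have "g \<longlonglongrightarrow> 1 * (2 * (1 / 2 - 0 - 0))"
    unfolding g_def by (intro tendsto_intros)
  then have "g \<longlonglongrightarrow> 1" by simp
  have CI: "\<forall>\<^sub>F n in sequentially. CI_class (d n) (S n) (U n) (L n)"
    and cov: "ereal (1 - \<alpha>) \<le> liminf (\<lambda>n. min_coverage (d n) (s n) (a n) (\<sigma> n) (S n) (U n) (L n))"
    using M by (auto simp: M_class_def)
  have "ereal c < liminf (\<lambda>n. min_coverage (d n) (s n) (a n) (\<sigma> n) (S n) (U n) (L n))"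
    using c(3) cov by (meson ereal_less_eq(3) less_ereal.simps(1) order_less_le_trans)
  then have cov': "\<forall>\<^sub>F n in sequentially.
      ereal c < min_coverage (d n) (s n) (a n) (\<sigma> n) (S n) (U n) (L n)"
    by (rule less_LiminfD)
  have "\<forall>\<^sub>F n in sequentially. ennreal (g n) \<le> max_length (d n) (s n) (a n) (\<sigma> n) (U n) (L n)
      / ennreal (\<sigma> n * sqrt (2 * ln (m n)) / 2)"
    using CI cov' ev m2 B1 s1 order_tendstoD(1)[OF \<open>g \<longlonglongrightarrow> 1\<close> zero_less_one]
  proof eventually_elim
    case (elim n)
    define h where "h = sqrt (2 * ln (m n / B n))"
    have "B n \<le> m n" using elim ln_le_minus_one[of "real (m n)"] by linarith
    then have mB: "1 \<le> real (m n) / B n" using elim by simp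
    then have h: "0 \<le> h" "exp (h\<^sup>2 / 2) = m n / B n"
      using elim by (auto simp: h_def)
    have l: "0 < sqrt (2 * ln (m n))" using elim by simp
    obtain T where T: "T \<subseteq> {1..d n}" "card T = m n"
      "(\<lambda>j\<in>{1..d n}. if j \<in> T then t n else 0) \<in> Theta (d n) (s n) (a n)"
      using elim by blast
    have eq: "h * \<sigma> n * (1 / 2 - 2 * K / s n - exp (h\<^sup>2 / 2) * (2 * K / m n)) =
        g n * (\<sigma> n * sqrt (2 * ln (m n)) / 2)"
      unfolding g_def q_def h(2) using l elim by (simp add: h_def)
    have "ennreal (g n * (\<sigma> n * sqrt (2 * ln (m n)) / 2))
        \<le> max_length (d n) (s n) (a n) (\<sigma> n) (U n) (L n)"
      unfolding eq[symmetric] K_def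
      by (rule max_length_ge[where S = "S n" and T = T and t = "t n"])
        (use elim T h \<sigma> c in \<open>auto simp: h_def\<close>)
    from divide_right_mono_ennreal[OF this, of "ennreal (\<sigma> n * sqrt (2 * ln (m n)) / 2)"]
    show ?case
      using l elim \<sigma>[of n] by (subst (asm) divide_ennreal) auto
  qed
  then have "liminf (\<lambda>n. ennreal (g n)) \<le> liminf (\<lambda>n. max_length (d n) (s n) (a n) (\<sigma> n) (U n) (L n)
      / ennreal (\<sigma> n * sqrt (2 * ln (m n)) / 2))"
    by (rule Liminf_mono)
  moreover have "(\<lambda>n. ennreal (g n)) \<longlonglongrightarrow> ennreal 1"
    using \<open>g \<longlonglongrightarrow> 1\<close> by (rule tendsto_ennrealI)
  then have "liminf (\<lambda>n. ennreal (g n)) = 1"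
    using lim_imp_Liminf[OF trivial_limit_sequentially] by auto
  ultimately show ?thesis by simp
qed

lemma minimax_length_ge_sqrt_log_dimension:
  assumes \<alpha>: "0 < \<alpha>" "\<alpha> < 1" and as: "asymptotic_setting d s a \<sigma>"
    and A: "filterlim A at_top sequentially" "filterlim (\<lambda>n. real (d n) / A n) at_top sequentially"
    and ev: "\<forall>\<^sub>F n in sequentially. s n \<le> d n"
      "\<forall>\<^sub>F n in sequentially. a n / \<sigma> n \<le> sqrt (2 * ln (real (d n) / A n - 1))"
  shows "1 \<le> minimax_length_liminf d s a \<sigma> \<alpha> \<delta> (\<lambda>n. \<sigma> n * sqrt (2 * ln (real (d n))) / 2)"
  unfolding minimax_length_liminf_def
proof (rule INF_greatest, clarify)
  fix S U L assume M: "(S, U, L) \<in> M_class d s a \<sigma> \<alpha> \<delta>"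
  \<comment> \<open>The first entry makes \<open>h * \<sigma>\<close> at least a; the second keeps
    the logarithm of d / B asymptotic to that of d.\<close>
  define B where "B = (\<lambda>n. min (A n) (ln (real (d n))))"
  have d: "filterlim d at_top sequentially" and s: "filterlim s at_top sequentially"
    and a: "\<And>n. 0 < a n" and \<sigma>: "\<And>n. 0 < \<sigma> n"
    using as by (auto simp: asymptotic_setting_def)
  have "filterlim (\<lambda>n. ln (real (d n))) at_top sequentially"
    by (intro filterlim_compose[OF ln_at_top] filterlim_compose[OF filterlim_real_sequentially] d)
  then have B: "filterlim B at_top sequentially"
    using A(1) unfolding B_def filterlim_at_top by (auto simp: eventually_conj_iff)
  have B0: "\<forall>\<^sub>F n in sequentially. 1 \<le> B n" using B unfolding filterlim_at_top by (rule spec)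
  have dA: "\<forall>\<^sub>F n in sequentially. 2 \<le> real (d n) / A n" using A(2) unfolding filterlim_at_top by (rule spec)
  show "1 \<le> liminf (\<lambda>n. max_length (d n) (s n) (a n) (\<sigma> n) (U n) (L n) /
      ennreal (\<sigma> n * sqrt (2 * ln (real (d n))) / 2))"
  proof (rule liminf_max_length_ge[where B = B and t = "\<lambda>_. 0"])
    show "\<forall>\<^sub>F n in sequentially. a n \<le> \<bar>0 + sqrt (2 * ln (d n / B n)) * \<sigma> n\<bar>"
      using ev(2) B0 dA
    proof eventually_elim
      case (elim n)
      have "real (d n) / A n \<le> d n / B n"
        using elim(2) by (intro divide_left_mono) (auto simp: B_def)
      then have "ln (real (d n) / A n - 1) \<le> ln (d n / B n)"
        using elim(3) by (intro ln_mono) auto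
      then have "a n / \<sigma> n \<le> sqrt (2 * ln (d n / B n))"
        using elim(1) by (meson mult_left_mono order_trans real_sqrt_le_mono zero_le_numeral)
      then have "a n \<le> sqrt (2 * ln (d n / B n)) * \<sigma> n"
        using \<sigma>[of n] by (simp add: divide_le_eq)
      then show ?case by linarith
    qed
    \<comment> \<open>With t = 0 the base vector is zero, so it is admissible even though T consists
      of all coordinates.\<close>
    have "{1..d n} \<subseteq> {1..d n} \<and> card {1..d n} = d n \<and>
        (\<lambda>j\<in>{1..d n}. if j \<in> {1..d n} then 0 else 0) \<in> Theta (d n) (s n) (a n)" for n
      by (auto simp: Theta_def Rvec_def l0_norm_def cong: conj_cong)
    then show "\<forall>\<^sub>F n in sequentially. \<exists>T. T \<subseteq> {1..d n} \<and> card T = d n \<and>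
        (\<lambda>j\<in>{1..d n}. if j \<in> T then 0 else 0) \<in> Theta (d n) (s n) (a n)"
      by (intro always_eventually allI) blast
  qed (use M \<alpha> \<sigma> d s B ev in \<open>auto simp: B_def\<close>)
qed

text \<open>The base vector has s entries equal to a. Moving an entry upwards by a nonnegative
  amount keeps it at least a, so no separate comparison of a with h \<sigma> arises.\<close>

lemma minimax_length_ge_sqrt_log_sparsity:
  assumes \<alpha>: "0 < \<alpha>" "\<alpha> < 1" and as: "asymptotic_setting d s a \<sigma>"
    and ev: "\<forall>\<^sub>F n in sequentially. s n \<le> d n"
  shows "1 \<le> minimax_length_liminf d s a \<sigma> \<alpha> \<delta> (\<lambda>n. \<sigma> n * sqrt (2 * ln (real (s n))) / 2)"
  unfolding minimax_length_liminf_def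
proof (rule INF_greatest, clarify)
  fix S U L assume M: "(S, U, L) \<in> M_class d s a \<sigma> \<alpha> \<delta>"
  have s: "filterlim s at_top sequentially" and a: "\<And>n. 0 < a n" and \<sigma>: "\<And>n. 0 < \<sigma> n"
    using as by (auto simp: asymptotic_setting_def)
  have s': "filterlim (\<lambda>n. real (s n)) at_top sequentially"
    using s by (rule filterlim_compose[OF filterlim_real_sequentially])
  have B: "filterlim (\<lambda>n. ln (real (s n))) at_top sequentially"
    by (intro filterlim_compose[OF ln_at_top] s')
  show "1 \<le> liminf (\<lambda>n. max_length (d n) (s n) (a n) (\<sigma> n) (U n) (L n) /
      ennreal (\<sigma> n * sqrt (2 * ln (real (s n))) / 2))"
  proof (rule liminf_max_length_ge[where B = "\<lambda>n. ln (real (s n))" and t = a])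
    have "\<forall>\<^sub>F x::real in at_top. 0 \<le> sqrt (2 * ln (x / ln x))" by real_asymp
    from eventually_compose_filterlim[OF this s']
    show "\<forall>\<^sub>F n in sequentially. a n \<le> \<bar>a n + sqrt (2 * ln (s n / ln (real (s n)))) * \<sigma> n\<bar>"
    proof eventually_elim
      case (elim n)
      then show ?case using a[of n] \<sigma>[of n] mult_nonneg_nonneg[OF elim, of "\<sigma> n"] by linarith
    qed
    show "\<forall>\<^sub>F n in sequentially. \<exists>T. T \<subseteq> {1..d n} \<and> card T = s n \<and>
        (\<lambda>j\<in>{1..d n}. if j \<in> T then a n else 0) \<in> Theta (d n) (s n) (a n)"
      using ev
    proof eventually_elim
      case (elim n)
      have "card {j \<in> {1..d n}. (\<lambda>j\<in>{1..d n}. if j \<in> {1..s n} then a n else 0) j \<noteq> 0}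
          \<le> card {1..s n}"
        by (intro card_mono) (auto split: if_splits)
      then have "(\<lambda>j\<in>{1..d n}. if j \<in> {1..s n} then a n else 0) \<in> Theta (d n) (s n) (a n)"
        using a[of n] by (auto simp: Theta_def Rvec_def l0_norm_def)
      then show ?case using elim by (intro exI[of _ "{1..s n}"]) auto
    qed
  qed (use M \<alpha> \<sigma> s B in auto)
qed

subsection \<open>The two-stage procedure\<close>

lemma phi_ss_eq: "phi_ss s \<alpha>' \<delta> = Phi_inv ((1 + \<delta>) / 2) + quantile_bound 2 \<alpha>' (real s)"
  by (simp add: phi_ss_def quantile_bound_def mult.commute)

lemma phi_bar_eq:
  "phi_bar d s \<alpha> \<alpha>' = quantile_bound 4 (\<alpha> - \<alpha>') (real d - real s) + quantile_bound 2 \<alpha>' (real s)"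
  by (simp add: phi_bar_def quantile_bound_def mult.commute)

lemma TS_threshold_eq:
  "TS_threshold d s a \<sigma> \<alpha> \<alpha>' \<delta> =
    (if a / \<sigma> < phi_bar d s \<alpha> \<alpha>' then Phi_inv ((1 + \<delta>) / 2)
     else quantile_bound 4 (\<alpha> - \<alpha>') (real d - real s))"
  by (simp add: TS_threshold_def quantile_bound_def add.commute)

lemma TS_halfwidth_eq:
  "TS_halfwidth d s a \<sigma> \<alpha> \<alpha>' =
    (if a / \<sigma> < phi_bar d s \<alpha> \<alpha>' then quantile_bound 2 (\<alpha> - \<alpha>') (real d)
     else quantile_bound 4 (\<alpha> - \<alpha>') (real s))"
  by (simp add: TS_halfwidth_def quantile_bound_def)

section \<open>Error probabilities of a single thresholded interval\<close>

lemma measure_gauss_abs_ge_le: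
  assumes "0 < \<sigma>"
  shows "measure (gauss \<mu> \<sigma>) {y. v \<le> \<bar>(y - \<mu>) / \<sigma>\<bar>} \<le> 2 * upper_tail v"
proof -
  have "v \<le> \<bar>z\<bar> \<longleftrightarrow> z \<in> {v..} \<or> z \<in> {..- v}" for z :: real
    by auto
  then have eq: "{y. v \<le> \<bar>(y - \<mu>) / \<sigma>\<bar>} =
      {y. (y - \<mu>) / \<sigma> \<in> {v..}} \<union> {y. (y - \<mu>) / \<sigma> \<in> {..- v}}"
    by blast
  have upper: "measure (gauss \<mu> \<sigma>) {y. (y - \<mu>) / \<sigma> \<in> {v..}} = upper_tail v"
    unfolding upper_tail_def by (rule measure_gauss_standardize[OF assms atLeast_borel])
  have lower: "measure (gauss \<mu> \<sigma>) {y. (y - \<mu>) / \<sigma> \<in> {..- v}} = upper_tail v"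
    unfolding upper_tail_reflect[symmetric] by (rule measure_gauss_standardize[OF assms atMost_borel])
  have "measure (gauss \<mu> \<sigma>) {y. v \<le> \<bar>(y - \<mu>) / \<sigma>\<bar>} \<le> upper_tail v + upper_tail v"
    unfolding eq by (rule order_trans[OF measure_Un_le]) (simp_all only: upper lower, simp_all)
  then show ?thesis by simp
qed

text \<open>Both endpoints of the two-stage interval have this form, with opposite signs of c. It
  exhibits them as Borel functions of one coordinate, as \<open>CI_class\<close> demands.\<close>

definition thresholded :: "real \<Rightarrow> real \<Rightarrow> real \<Rightarrow> real \<Rightarrow> real" where
  "thresholded \<tau> \<sigma> c y = (if \<tau> \<le> \<bar>y / \<sigma>\<bar> then y + c else 0)"

lemma borel_measurable_thresholded [measurable]: "thresholded \<tau> \<sigma> c \<in> borel_measurable borel"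
  unfolding thresholded_def[abs_def] by measurable

lemma TS_U_eq: "j \<in> {1..d} \<Longrightarrow> TS_U d s a \<sigma> \<alpha> \<alpha>' \<delta> x j =
    thresholded (TS_threshold d s a \<sigma> \<alpha> \<alpha>' \<delta>) \<sigma> (TS_halfwidth d s a \<sigma> \<alpha> \<alpha>' * \<sigma>) (x j)"
  by (simp add: TS_U_def TS_S_def thresholded_def)

lemma TS_L_eq: "j \<in> {1..d} \<Longrightarrow> TS_L d s a \<sigma> \<alpha> \<alpha>' \<delta> x j =
    thresholded (TS_threshold d s a \<sigma> \<alpha> \<alpha>' \<delta>) \<sigma> (- (TS_halfwidth d s a \<sigma> \<alpha> \<alpha>' * \<sigma>)) (x j)"
  by (simp add: TS_L_def TS_S_def thresholded_def)

text \<open>A zero mean is missed only if the coordinate is selected and, moreover, the interval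
  around the observation excludes 0. Either event alone gives a bound; the minimum lets each regime
  use the bound that it has calibrated.\<close>

lemma miss_zero_le:
  assumes "0 < \<sigma>"
  shows "measure (gauss 0 \<sigma>) {y. 0 \<notin> {thresholded \<tau> \<sigma> (- (w * \<sigma>)) y..thresholded \<tau> \<sigma> (w * \<sigma>) y}}
    \<le> min (2 * upper_tail \<tau>) (2 * upper_tail w)"
proof -
  interpret prob_space "gauss 0 \<sigma>" by (rule prob_space_normal_density) fact
  let ?A = "{y. 0 \<notin> {thresholded \<tau> \<sigma> (- (w * \<sigma>)) y..thresholded \<tau> \<sigma> (w * \<sigma>) y}}"
  have "?A \<subseteq> {y. \<tau> \<le> \<bar>(y - 0) / \<sigma>\<bar>}"
    by (auto simp: thresholded_def)
  then have "prob ?A \<le> prob {y. \<tau> \<le> \<bar>(y - 0) / \<sigma>\<bar>}"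
    by (rule finite_measure_mono) simp
  moreover have "w \<le> \<bar>(y - 0) / \<sigma>\<bar>" if "y \<in> ?A" for y
  proof -
    have "w * \<sigma> \<le> \<bar>y\<bar>" using that by (auto simp: thresholded_def split: if_splits)
    then show ?thesis using assms by (simp add: pos_le_divide_eq abs_divide)
  qed
  then have "?A \<subseteq> {y. w \<le> \<bar>(y - 0) / \<sigma>\<bar>}" by blast
  then have "prob ?A \<le> prob {y. w \<le> \<bar>(y - 0) / \<sigma>\<bar>}"
    by (rule finite_measure_mono) simp
  ultimately show ?thesis
    using measure_gauss_abs_ge_le[OF assms, of 0 \<tau>] measure_gauss_abs_ge_le[OF assms, of 0 w] by linarith
qed

text \<open>A nonzero coordinate is discarded only by a deviation towards \<open>0\<close>; since this is a one-sided
  event, only half of the error budget \<open>\<alpha>'\<close> is used up, and the remaining half absorbs all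
  asymptotic errors.\<close>

lemma miss_nonzero_le:
  assumes "0 < \<sigma>" "0 < a" "a \<le> \<bar>t\<bar>"
  shows "measure (gauss t \<sigma>) {y. t \<notin> {thresholded \<tau> \<sigma> (- (w * \<sigma>)) y..thresholded \<tau> \<sigma> (w * \<sigma>) y}}
    \<le> 2 * upper_tail w + upper_tail (a / \<sigma> - \<tau>)"
proof -
  interpret prob_space "gauss t \<sigma>" by (rule prob_space_normal_density) fact
  let ?A = "{y. t \<notin> {thresholded \<tau> \<sigma> (- (w * \<sigma>)) y..thresholded \<tau> \<sigma> (w * \<sigma>) y}}"
  let ?H = "if 0 < t then {..- (a / \<sigma> - \<tau>)} else {a / \<sigma> - \<tau>..}"
  have "y \<in> {y. w \<le> \<bar>(y - t) / \<sigma>\<bar>} \<union> {y. (y - t) / \<sigma> \<in> ?H}" if y: "y \<in> ?A" for y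
  proof (cases "\<tau> \<le> \<bar>y / \<sigma>\<bar>")
    case True
    then have "w * \<sigma> \<le> \<bar>y - t\<bar>" using y by (auto simp: thresholded_def split: if_splits)
    then show ?thesis using assms(1) by (simp add: pos_le_divide_eq abs_divide)
  next
    case False
    then have *: "y / \<sigma> < \<tau>" "- \<tau> < y / \<sigma>" by linarith+
    have "(y - t) / \<sigma> = y / \<sigma> - t / \<sigma>" by (rule diff_divide_distrib)
    moreover have "a / \<sigma> \<le> t / \<sigma>" if "0 < t"
      using that assms by (intro divide_right_mono) auto
    moreover have "a / \<sigma> \<le> - t / \<sigma>" if "\<not> 0 < t"
      using that assms by (intro divide_right_mono) auto
    ultimately show ?thesis using * by auto
  qed
  then have "prob ?A \<le> prob ({y. w \<le> \<bar>(y - t) / \<sigma>\<bar>} \<union> {y. (y - t) / \<sigma> \<in> ?H})"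
    by (intro finite_measure_mono subsetI) simp_all
  also have "\<dots> \<le> prob {y. w \<le> \<bar>(y - t) / \<sigma>\<bar>} + prob {y. (y - t) / \<sigma> \<in> ?H}"
    by (intro measure_Un_le) simp_all
  also have "prob {y. (y - t) / \<sigma> \<in> ?H} = measure std_normal_distribution ?H"
    by (intro measure_gauss_standardize assms) simp
  also have "\<dots> = upper_tail (a / \<sigma> - \<tau>)"
    by (cases "0 < t") (simp_all only: upper_tail_reflect if_True if_False upper_tail_def)
  finally show ?thesis using measure_gauss_abs_ge_le[OF assms(1), of t w] by linarith
qed

section \<open>Membership of the two-stage procedure in the class\<close>

lemma CI_class_TS:
  assumes "0 < \<sigma>" "0 \<le> TS_halfwidth d s a \<sigma> \<alpha> \<alpha>'"
  shows "CI_class d (TS_S d s a \<sigma> \<alpha> \<alpha>' \<delta>) (TS_U d s a \<sigma> \<alpha> \<alpha>' \<delta>) (TS_L d s a \<sigma> \<alpha> \<alpha>' \<delta>)"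
proof -
  have "TS_L d s a \<sigma> \<alpha> \<alpha>' \<delta> x j \<le> TS_U d s a \<sigma> \<alpha> \<alpha>' \<delta> x j" for x j
  proof -
    have "0 \<le> TS_halfwidth d s a \<sigma> \<alpha> \<alpha>' * \<sigma>" using assms by simp
    then show ?thesis by (simp add: TS_L_def TS_U_def)
  qed
  moreover have "TS_L d s a \<sigma> \<alpha> \<alpha>' \<delta> x j = 0 \<and> TS_U d s a \<sigma> \<alpha> \<alpha>' \<delta> x j = 0"
    if "j \<in> {1..d} - TS_S d s a \<sigma> \<alpha> \<alpha>' \<delta> x" for x j
    using that by (simp add: TS_L_def TS_U_def)
  moreover have "TS_S d s a \<sigma> \<alpha> \<alpha>' \<delta> x \<subseteq> {1..d}" for x by (auto simp: TS_S_def)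
  ultimately show ?thesis
    unfolding CI_class_def
    by (intro conjI ballI) (blast intro: TS_U_eq TS_L_eq borel_measurable_thresholded)+
qed

text \<open>At the threshold \<open>Phi_inv ((1 + \<delta>) / 2)\<close> each of the two tails has
  mass (1 - \<delta>) / 2, so the selection probability meets the constraint with equality; a larger
  threshold only lowers it.\<close>

lemma F_class_TS:
  assumes "0 < \<sigma>" "0 < \<delta>" "\<delta> < 1" "Phi_inv ((1 + \<delta>) / 2) \<le> TS_threshold d s a \<sigma> \<alpha> \<alpha>' \<delta>"
  shows "F_class d \<sigma> \<delta> (TS_S d s a \<sigma> \<alpha> \<alpha>' \<delta>)"
  unfolding F_class_def
proof (intro conjI ballI)
  let ?\<tau> = "TS_threshold d s a \<sigma> \<alpha> \<alpha>' \<delta>"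
  fix j assume j: "j \<in> {1..d}"
  have B: "{y. ?\<tau> \<le> \<bar>y / \<sigma>\<bar>} \<in> sets borel" by simp
  have iff: "j \<in> TS_S d s a \<sigma> \<alpha> \<alpha>' \<delta> x \<longleftrightarrow> x j \<in> {y. ?\<tau> \<le> \<bar>y / \<sigma>\<bar>}" for x
    using j by (simp add: TS_S_def)
  show "\<exists>B\<in>sets borel. \<forall>x\<in>Rvec d. j \<in> TS_S d s a \<sigma> \<alpha> \<alpha>' \<delta> x \<longleftrightarrow> x j \<in> B"
    using B iff by blast
  have "measure (gauss_model d (\<lambda>k\<in>{1..d}. 0) \<sigma>) {x \<in> Rvec d. j \<in> TS_S d s a \<sigma> \<alpha> \<alpha>' \<delta> x} =
      measure (gauss 0 \<sigma>) {y. ?\<tau> \<le> \<bar>(y - 0) / \<sigma>\<bar>}"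
    unfolding iff measure_gauss_model_component[OF assms(1) j B] using j by simp
  also have "\<dots> \<le> 2 * upper_tail ?\<tau>"
    by (rule measure_gauss_abs_ge_le) fact
  also have "\<dots> \<le> 2 * upper_tail (Phi_inv ((1 + \<delta>) / 2))"
    using upper_tail_antimono[OF assms(4)] by simp
  also have "\<dots> = 1 - \<delta>"
    using Phi_Phi_inv[of "(1 + \<delta>) / 2"] assms by (simp add: Phi_eq field_simps)
  finally show "measure (gauss_model d (\<lambda>k\<in>{1..d}. 0) \<sigma>) {x \<in> Rvec d. j \<in> TS_S d s a \<sigma> \<alpha> \<alpha>' \<delta> x} \<le> 1 - \<delta>" .
qed (auto simp: TS_S_def)

text \<open>The two alternatives are the error budgets of the two regimes: in the first the
  half-width protects all d coordinates, in the second it protects s of them and the threshold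
  protects the other d - s.\<close>

lemma min_coverage_TS_ge:
  fixes d s :: nat and a \<sigma> \<alpha> \<alpha>' \<delta> :: real
  defines "\<tau> \<equiv> TS_threshold d s a \<sigma> \<alpha> \<alpha>' \<delta>" and "w \<equiv> TS_halfwidth d s a \<sigma> \<alpha> \<alpha>'"
  assumes \<sigma>: "0 < \<sigma>" and a: "0 < a" and s: "s \<le> d" and w: "0 \<le> w"
    and err: "d * (2 * upper_tail w) + s * upper_tail (a / \<sigma> - \<tau>) \<le> \<alpha> \<or>
      (real d - real s) * (2 * upper_tail \<tau>) + s * (2 * upper_tail w) + s * upper_tail (a / \<sigma> - \<tau>) \<le> \<alpha>"
  shows "ereal (1 - \<alpha>) \<le> min_coverage d s a \<sigma> (TS_S d s a \<sigma> \<alpha> \<alpha>' \<delta>)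
    (TS_U d s a \<sigma> \<alpha> \<alpha>' \<delta>) (TS_L d s a \<sigma> \<alpha> \<alpha>' \<delta>)"
  unfolding min_coverage_def
proof (rule INF_greatest)
  fix \<theta> assume "\<theta> \<in> Theta d s a"
  then have \<theta>: "\<theta> \<in> Rvec d" "l0_norm d \<theta> \<le> s"
    "\<And>j. j \<in> {1..d} \<Longrightarrow> \<theta> j \<noteq> 0 \<Longrightarrow> a \<le> \<bar>\<theta> j\<bar>"
    by (auto simp: Theta_def)
  let ?l = "thresholded \<tau> \<sigma> (- (w * \<sigma>))" and ?u = "thresholded \<tau> \<sigma> (w * \<sigma>)"
  let ?miss = "\<lambda>t. measure (gauss t \<sigma>) {y. t \<notin> {?l y..?u y}}"
  let ?m = "min (2 * upper_tail \<tau>) (2 * upper_tail w)" and ?v = "upper_tail (a / \<sigma> - \<tau>)"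
  let ?J = "{j \<in> {1..d}. \<theta> j \<noteq> 0}" and ?k = "l0_norm d \<theta>"
  have hit: "measure (gauss t \<sigma>) {y. t \<in> {?l y..?u y}} = 1 - ?miss t" for t
  proof -
    interpret prob_space "gauss t \<sigma>" by (rule prob_space_normal_density) fact
    have "{y. t \<in> {?l y..?u y}} \<in> sets borel" by simp
    moreover have "space (gauss t \<sigma>) - {y. t \<in> {?l y..?u y}} = {y. t \<notin> {?l y..?u y}}" by auto
    ultimately show ?thesis
      using prob_compl[of "{y. t \<in> {?l y..?u y}}"] by simp
  qed
  have k: "?k = card ?J" "card ({1..d} - ?J) = d - ?k" "?k \<le> s"
    using \<theta>(2) card_Diff_subset[of ?J "{1..d}", OF _ Collect_restrict] by (simp_all add: l0_norm_def)
  have Q: "0 \<le> upper_tail v" for v by (simp add: upper_tail_def)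
  have split: "(\<Sum>j\<in>{1..d}. ?miss (\<theta> j)) = (\<Sum>j\<in>{1..d} - ?J. ?miss (\<theta> j)) + (\<Sum>j\<in>?J. ?miss (\<theta> j))"
    by (rule sum.subset_diff) auto
  have nonzero: "(\<Sum>j\<in>?J. ?miss (\<theta> j)) \<le> ?k * (2 * upper_tail w + ?v)"
    unfolding k(1) by (rule sum_bounded_above, rule miss_nonzero_le[OF \<sigma> a]) (use \<theta>(3) in auto)
  have "(\<Sum>j\<in>{1..d} - ?J. ?miss (\<theta> j)) \<le> real (card ({1..d} - ?J)) * ?m"
  proof (rule sum_bounded_above)
    fix j assume "j \<in> {1..d} - ?J"
    then have "\<theta> j = 0" by auto
    then show "?miss (\<theta> j) \<le> ?m" using miss_zero_le[OF \<sigma>, of \<tau> w] by simp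
  qed
  also have "real (card ({1..d} - ?J)) = real d - real ?k" using k s by simp
  finally have sum: "(\<Sum>j\<in>{1..d}. ?miss (\<theta> j)) \<le>
      ?k * (2 * upper_tail w) + ?k * ?v + (real d - real ?k) * ?m"
    using split nonzero by (simp add: distrib_left)
  have kv: "?k * ?v \<le> s * ?v" using k(3) Q by (intro mult_right_mono) auto
  have "(real d - real ?k) * ?m \<le> (real d - real ?k) * (2 * upper_tail w)"
    using k(3) s by (intro mult_left_mono) auto
  \<comment> \<open>A parameter with fewer than s nonzero entries has more than d - s zeros. The
    surplus zeros are charged to the half-width, which is budgeted for s coordinates.\<close>
  moreover have "(real d - real ?k) * ?m \<le>
      (real d - real s) * (2 * upper_tail \<tau>) + (real s - real ?k) * (2 * upper_tail w)"
  proof -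
    have "(real d - real ?k) * ?m = (real d - real s) * ?m + (real s - real ?k) * ?m"
      by (simp add: algebra_simps)
    also have "\<dots> \<le> (real d - real s) * (2 * upper_tail \<tau>) + (real s - real ?k) * (2 * upper_tail w)"
      using k(3) s by (intro add_mono mult_left_mono) auto
    finally show ?thesis .
  qed
  ultimately have "(\<Sum>j\<in>{1..d}. ?miss (\<theta> j)) \<le> \<alpha>"
    using sum kv err by (auto simp: algebra_simps)
  moreover have "1 - (\<Sum>j\<in>{1..d}. ?miss (\<theta> j)) \<le> (\<Prod>j\<in>{1..d}. 1 - ?miss (\<theta> j))"
    by (intro Weierstrass_prod_ineq)
      (auto intro!: prob_space.prob_le_1 prob_space_normal_density \<sigma>)
  moreover have "measure (gauss_model d \<theta> \<sigma>) {x \<in> Rvec d. \<theta> \<in> conf_set d (TS_S d s a \<sigma> \<alpha> \<alpha>' \<delta>)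
      (TS_U d s a \<sigma> \<alpha> \<alpha>' \<delta>) (TS_L d s a \<sigma> \<alpha> \<alpha>' \<delta>) x} =
      (\<Prod>j\<in>{1..d}. measure (gauss (\<theta> j) \<sigma>) {y. \<theta> j \<in> {?l y..?u y}})"
    by (rule coverage_eq_prod[OF \<sigma> CI_class_TS[OF \<sigma>] \<theta>(1)])
      (use w in \<open>simp_all add: TS_U_eq TS_L_eq \<tau>_def w_def\<close>)
  ultimately show "ereal (1 - \<alpha>) \<le> ereal (measure (gauss_model d \<theta> \<sigma>)
      {x \<in> Rvec d. \<theta> \<in> conf_set d (TS_S d s a \<sigma> \<alpha> \<alpha>' \<delta>)
        (TS_U d s a \<sigma> \<alpha> \<alpha>' \<delta>) (TS_L d s a \<sigma> \<alpha> \<alpha>' \<delta>) x})"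
    unfolding hit ereal_less_eq by linarith
qed

text \<open>The tail estimates concern functions of one real argument, so a single N works for all
  sequences at once: it suffices that s and d - s exceed it.\<close>

lemma TS_in_M_eventually:
  fixes \<alpha> \<alpha>' \<delta> :: real
  assumes \<delta>: "0 < \<delta>" "\<delta> < 1" and \<alpha>: "0 < \<alpha>'" "\<alpha>' < \<alpha>"
  shows "\<exists>N. \<forall>d s a \<sigma>. asymptotic_setting d s a \<sigma> \<longrightarrow>
    (\<forall>\<^sub>F n in sequentially. N \<le> d n - s n) \<longrightarrow>
    (\<forall>\<^sub>F n in sequentially. phi_ss (s n) \<alpha>' \<delta> \<le> a n / \<sigma> n \<or> phi_bar (d n) (s n) \<alpha> \<alpha>' \<le> a n / \<sigma> n) \<longrightarrow>
    TS_in_M d s a \<sigma> \<alpha> \<alpha>' \<delta>"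
proof -
  define \<beta> where "\<beta> = \<alpha> - \<alpha>'"
  have \<beta>: "0 < \<beta>" using \<alpha> by (simp add: \<beta>_def)
  define p where "p = Phi_inv ((1 + \<delta>) / 2)"
  have p: "0 < p" unfolding p_def by (rule Phi_inv_pos) (use \<delta> in auto)
  have qb: "\<forall>\<^sub>F x in at_top. v \<le> quantile_bound \<kappa> \<beta> x" if "0 < \<kappa>" for \<kappa> v
    using filterlim_quantile_bound[OF \<beta> that] unfolding filterlim_at_top by blast
  \<comment> \<open>The limits are at most \<beta> / 2, \<alpha>' / 2 and \<beta> / 4; the excess is
    the slack. The first regime then spends \<beta> + \<alpha>' / 8 + 3 \<alpha>' / 4, the second
    \<beta> + \<alpha>' / 4 + 3 \<alpha>' / 4, and neither exceeds \<alpha>.\<close>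
  have "\<forall>\<^sub>F x in at_top. x * upper_tail (quantile_bound 2 \<beta> x) \<le> \<beta> / 2 + \<alpha>' / 16 \<and>
      x * upper_tail (quantile_bound 2 \<alpha>' x) \<le> 3 * \<alpha>' / 4 \<and>
      x * upper_tail (quantile_bound 4 \<beta> x) \<le> \<beta> / 4 + \<alpha>' / 16 \<and>
      0 \<le> quantile_bound 2 \<beta> x \<and> 0 \<le> quantile_bound 4 \<beta> x \<and> p \<le> quantile_bound 4 \<beta> x"
    using \<alpha> \<beta> by (intro eventually_conj upper_tail_quantile_bound qb) auto
  then obtain X where X: "\<And>x. X \<le> x \<Longrightarrow>
      x * upper_tail (quantile_bound 2 \<beta> x) \<le> \<beta> / 2 + \<alpha>' / 16"
    "\<And>x. X \<le> x \<Longrightarrow> x * upper_tail (quantile_bound 2 \<alpha>' x) \<le> 3 * \<alpha>' / 4"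
    "\<And>x. X \<le> x \<Longrightarrow> x * upper_tail (quantile_bound 4 \<beta> x) \<le> \<beta> / 4 + \<alpha>' / 16"
    "\<And>x. X \<le> x \<Longrightarrow> 0 \<le> quantile_bound 2 \<beta> x" "\<And>x. X \<le> x \<Longrightarrow> 0 \<le> quantile_bound 4 \<beta> x"
    "\<And>x. X \<le> x \<Longrightarrow> p \<le> quantile_bound 4 \<beta> x"
    unfolding eventually_at_top_linorder by blast
  \<comment> \<open>The maximum with 1 excludes a truncated difference, so
    \<open>N \<le> d n - s n\<close> implies s < d.\<close>
  define N where "N = max 1 (nat \<lceil>X\<rceil>)"
  have N: "X \<le> real m" if "N \<le> m" for m
    using that real_nat_ceiling_ge[of X] unfolding N_def by linarith
  have "1 \<le> N" by (simp add: N_def)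
  show ?thesis
  proof (intro exI[of _ N] allI impI)
    fix d s :: "nat \<Rightarrow> nat" and a \<sigma> :: "nat \<Rightarrow> real"
    assume as: "asymptotic_setting d s a \<sigma>" and D: "\<forall>\<^sub>F n in sequentially. N \<le> d n - s n"
      and strong: "\<forall>\<^sub>F n in sequentially.
        phi_ss (s n) \<alpha>' \<delta> \<le> a n / \<sigma> n \<or> phi_bar (d n) (s n) \<alpha> \<alpha>' \<le> a n / \<sigma> n"
    have a: "\<And>n. 0 < a n" and \<sigma>: "\<And>n. 0 < \<sigma> n" and s: "\<forall>\<^sub>F n in sequentially. N \<le> s n"
      using as unfolding asymptotic_setting_def filterlim_at_top by auto
    have ev: "\<forall>\<^sub>F n in sequentially.
        CI_class (d n) (TS_S (d n) (s n) (a n) (\<sigma> n) \<alpha> \<alpha>' \<delta>)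
          (TS_U (d n) (s n) (a n) (\<sigma> n) \<alpha> \<alpha>' \<delta>) (TS_L (d n) (s n) (a n) (\<sigma> n) \<alpha> \<alpha>' \<delta>) \<and>
        F_class (d n) (\<sigma> n) \<delta> (TS_S (d n) (s n) (a n) (\<sigma> n) \<alpha> \<alpha>' \<delta>) \<and>
        ereal (1 - \<alpha>) \<le> min_coverage (d n) (s n) (a n) (\<sigma> n) (TS_S (d n) (s n) (a n) (\<sigma> n) \<alpha> \<alpha>' \<delta>)
          (TS_U (d n) (s n) (a n) (\<sigma> n) \<alpha> \<alpha>' \<delta>) (TS_L (d n) (s n) (a n) (\<sigma> n) \<alpha> \<alpha>' \<delta>)"
      using D strong s
    proof eventually_elim
      case (elim n)
      let ?w = "TS_halfwidth (d n) (s n) (a n) (\<sigma> n) \<alpha> \<alpha>'"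
      let ?\<tau> = "TS_threshold (d n) (s n) (a n) (\<sigma> n) \<alpha> \<alpha>' \<delta>"
      have sd: "s n < d n" using elim(1) \<open>1 \<le> N\<close> by linarith
      then have diff: "real (d n) - real (s n) = real (d n - s n)" by simp
      have XX: "X \<le> real (s n)" "X \<le> real (d n)" "X \<le> real (d n) - real (s n)"
        unfolding diff by (rule N, use elim sd in linarith)+
      have w: "0 \<le> ?w"
        unfolding TS_halfwidth_eq using X(4,5) XX by (auto simp: \<beta>_def)
      have \<tau>: "p \<le> ?\<tau>"
        unfolding TS_threshold_eq using X(6) XX by (auto simp: \<beta>_def p_def)
      \<comment> \<open>Both \<open>phi_ss\<close> and \<open>phi_bar\<close> are the threshold of
        their regime plus this quantile, so the remaining margin is the same in both cases.\<close>
      have gap: "quantile_bound 2 \<alpha>' (s n) \<le> a n / \<sigma> n - ?\<tau>"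
        using elim(2) unfolding TS_threshold_eq phi_ss_eq phi_bar_eq by (auto split: if_splits)
      have "s n * upper_tail (a n / \<sigma> n - ?\<tau>) \<le> s n * upper_tail (quantile_bound 2 \<alpha>' (s n))"
        by (intro mult_left_mono upper_tail_antimono gap) simp
      also have "\<dots> \<le> 3 * \<alpha>' / 4" by (rule X(2)) fact
      finally have e1: "s n * upper_tail (a n / \<sigma> n - ?\<tau>) \<le> 3 * \<alpha>' / 4" .
      have err: "d n * (2 * upper_tail ?w) + s n * upper_tail (a n / \<sigma> n - ?\<tau>) \<le> \<alpha> \<or>
        (real (d n) - real (s n)) * (2 * upper_tail ?\<tau>) + s n * (2 * upper_tail ?w)
          + s n * upper_tail (a n / \<sigma> n - ?\<tau>) \<le> \<alpha>"
      proof (cases "a n / \<sigma> n < phi_bar (d n) (s n) \<alpha> \<alpha>'")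
        case True
        then have "?w = quantile_bound 2 \<beta> (d n)" by (simp add: TS_halfwidth_eq \<beta>_def)
        then have "d n * (2 * upper_tail ?w) \<le> 2 * (\<beta> / 2 + \<alpha>' / 16)"
          using X(1)[OF XX(2)] by simp
        from add_mono[OF this e1]
        have "d n * (2 * upper_tail ?w) + s n * upper_tail (a n / \<sigma> n - ?\<tau>) \<le> \<alpha>"
          by (rule order_trans) (use \<alpha> in \<open>simp add: \<beta>_def field_simps\<close>)
        then show ?thesis by (rule disjI1)
      next
        case False
        then have "?w = quantile_bound 4 \<beta> (s n)" "?\<tau> = quantile_bound 4 \<beta> (real (d n) - real (s n))"
          by (simp_all add: TS_halfwidth_eq TS_threshold_eq \<beta>_def)
        then have "s n * (2 * upper_tail ?w) \<le> 2 * (\<beta> / 4 + \<alpha>' / 16)"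
          "(real (d n) - real (s n)) * (2 * upper_tail ?\<tau>) \<le> 2 * (\<beta> / 4 + \<alpha>' / 16)"
          using X(3)[OF XX(1)] X(3)[OF XX(3)] by (auto simp: mult.left_commute)
        from add_mono[OF add_mono[OF this(2,1)] e1]
        have "(real (d n) - real (s n)) * (2 * upper_tail ?\<tau>) + s n * (2 * upper_tail ?w)
            + s n * upper_tail (a n / \<sigma> n - ?\<tau>) \<le> \<alpha>"
          by (rule order_trans) (use \<alpha> in \<open>simp add: \<beta>_def field_simps\<close>)
        then show ?thesis by (rule disjI2)
      qed
      show ?case
        using CI_class_TS[OF \<sigma> w] F_class_TS[OF \<sigma> \<delta> \<tau>[unfolded p_def]]
          min_coverage_TS_ge[OF \<sigma> a less_imp_le[OF sd] w err] by blast
    qed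
    show "TS_in_M d s a \<sigma> \<alpha> \<alpha>' \<delta>"
      unfolding TS_in_M_def M_class_def
    proof (clarify, intro conjI)
      show "ereal (1 - \<alpha>) \<le> liminf (\<lambda>n. min_coverage (d n) (s n) (a n) (\<sigma> n)
          (TS_S (d n) (s n) (a n) (\<sigma> n) \<alpha> \<alpha>' \<delta>)
          (TS_U (d n) (s n) (a n) (\<sigma> n) \<alpha> \<alpha>' \<delta>) (TS_L (d n) (s n) (a n) (\<sigma> n) \<alpha> \<alpha>' \<delta>))"
        using ev by (intro Liminf_bounded) (auto elim: eventually_mono)
    qed (use ev in \<open>auto elim: eventually_mono\<close>)
  qed
qed

section \<open>Expected length of the two-stage procedure\<close>

lemma max_length_TS_le:
  assumes "0 < \<sigma>" "TS_halfwidth d s a \<sigma> \<alpha> \<alpha>' \<le> w"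
  shows "max_length d s a \<sigma> (TS_U d s a \<sigma> \<alpha> \<alpha>' \<delta>) (TS_L d s a \<sigma> \<alpha> \<alpha>' \<delta>) \<le> ennreal (2 * w * \<sigma>)"
  unfolding max_length_def
proof (intro SUP_least)
  fix j \<theta>
  interpret prob_space "gauss_model d \<theta> \<sigma>" by (rule prob_space_gauss_model) fact
  have "TS_halfwidth d s a \<sigma> \<alpha> \<alpha>' * \<sigma> \<le> w * \<sigma>" using assms by simp
  then have "(\<integral>\<^sup>+ x. ennreal (TS_U d s a \<sigma> \<alpha> \<alpha>' \<delta> x j - TS_L d s a \<sigma> \<alpha> \<alpha>' \<delta> x j) \<partial>gauss_model d \<theta> \<sigma>)
      \<le> (\<integral>\<^sup>+ x. ennreal (2 * w * \<sigma>) \<partial>gauss_model d \<theta> \<sigma>)"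
    by (intro nn_integral_mono) (auto simp: TS_U_def TS_L_def mult.commute intro!: ennreal_leI)
  also have "\<dots> = ennreal (2 * w * \<sigma>)" by (simp add: emeasure_space_1)
  finally show "(\<integral>\<^sup>+ x. ennreal (TS_U d s a \<sigma> \<alpha> \<alpha>' \<delta> x j - TS_L d s a \<sigma> \<alpha> \<alpha>' \<delta> x j)
      \<partial>gauss_model d \<theta> \<sigma>) \<le> ennreal (2 * w * \<sigma>)" .
qed

lemma TS_length_limsup_le:
  fixes d s m :: "nat \<Rightarrow> nat"
  assumes \<sigma>: "\<And>n. 0 < \<sigma> n" and m: "filterlim m at_top sequentially" and c: "0 < c" "0 \<le> b"
    and w: "\<forall>\<^sub>F n in sequentially.
      TS_halfwidth (d n) (s n) (a n) (\<sigma> n) \<alpha> \<alpha>' \<le> sqrt (2 * ln (c * (real (m n) + b)))"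
  shows "TS_length_limsup d s a \<sigma> \<alpha> \<alpha>' \<delta> (\<lambda>n. 2 * \<sigma> n * sqrt (2 * ln (real (m n)))) \<le> 1"
proof -
  define g where "g = (\<lambda>n. sqrt (2 * ln (c * (real (m n) + b))) / sqrt (2 * ln (real (m n))))"
  have "filterlim (\<lambda>n. real (m n)) at_top sequentially"
    using m by (rule filterlim_compose[OF filterlim_real_sequentially])
  from filterlim_compose[OF sqrt_ln_affine_ratio[OF c] this] have g: "g \<longlonglongrightarrow> 1"
    unfolding g_def .
  have m2: "\<forall>\<^sub>F n in sequentially. 2 \<le> m n"
    using m unfolding filterlim_at_top by (rule spec)
  have "\<forall>\<^sub>F n in sequentially. max_length (d n) (s n) (a n) (\<sigma> n)
      (TS_U (d n) (s n) (a n) (\<sigma> n) \<alpha> \<alpha>' \<delta>) (TS_L (d n) (s n) (a n) (\<sigma> n) \<alpha> \<alpha>' \<delta>)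
      / ennreal (2 * \<sigma> n * sqrt (2 * ln (real (m n)))) \<le> ennreal (g n)"
    using w m2 order_tendstoD(1)[OF g zero_less_one]
  proof eventually_elim
    case (elim n)
    let ?r = "2 * \<sigma> n * sqrt (2 * ln (real (m n)))"
    have l: "0 < sqrt (2 * ln (real (m n)))" using elim(2) by simp
    have eq: "2 * sqrt (2 * ln (c * (real (m n) + b))) * \<sigma> n = g n * ?r"
      using l by (simp add: g_def)
    have "max_length (d n) (s n) (a n) (\<sigma> n)
        (TS_U (d n) (s n) (a n) (\<sigma> n) \<alpha> \<alpha>' \<delta>) (TS_L (d n) (s n) (a n) (\<sigma> n) \<alpha> \<alpha>' \<delta>) \<le> ennreal (g n * ?r)"
      unfolding eq[symmetric] by (rule max_length_TS_le[OF \<sigma> elim(1)])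
    then have "max_length (d n) (s n) (a n) (\<sigma> n)
        (TS_U (d n) (s n) (a n) (\<sigma> n) \<alpha> \<alpha>' \<delta>) (TS_L (d n) (s n) (a n) (\<sigma> n) \<alpha> \<alpha>' \<delta>) / ennreal ?r
        \<le> ennreal (g n * ?r) / ennreal ?r"
      by (rule divide_right_mono_ennreal)
    also have "\<dots> = ennreal (g n)"
      using l elim(3) \<sigma>[of n] by (subst divide_ennreal) auto
    finally show ?case .
  qed
  then have "TS_length_limsup d s a \<sigma> \<alpha> \<alpha>' \<delta> (\<lambda>n. 2 * \<sigma> n * sqrt (2 * ln (real (m n))))
      \<le> limsup (\<lambda>n. ennreal (g n))"
    unfolding TS_length_limsup_def by (rule Limsup_mono)
  moreover have "(\<lambda>n. ennreal (g n)) \<longlonglongrightarrow> ennreal 1"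
    using g by (rule tendsto_ennrealI)
  then have "limsup (\<lambda>n. ennreal (g n)) = 1"
    using lim_imp_Limsup[OF trivial_limit_sequentially] by auto
  ultimately show ?thesis by simp
qed

text \<open>If d < 2 s, the upper end of the signal window is at most
  \<open>sqrt (2 * ln (2 * s))\<close>, because A is at least 1. But \<open>phi_ss\<close>
  eventually exceeds this, its first summand being a positive constant. So a nonempty window forces
  d - s to be at least s.\<close>

lemma two_sparsity_le_dimension:
  assumes \<delta>: "0 < \<delta>" "\<delta> < 1" and \<alpha>': "0 < \<alpha>'"
    and s: "filterlim s at_top sequentially" and A: "filterlim A at_top sequentially"
    and dA: "filterlim (\<lambda>n. real (d n) / A n) at_top sequentially"
    and ev: "\<forall>\<^sub>F n in sequentially. phi_ss (s n) \<alpha>' \<delta> \<le> sqrt (2 * ln (real (d n) / A n - 1))"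
  shows "\<forall>\<^sub>F n in sequentially. 2 * s n \<le> d n"
proof -
  have "0 < Phi_inv ((1 + \<delta>) / 2)" by (rule Phi_inv_pos) (use \<delta> in auto)
  from sqrt_ln_gap[OF \<alpha>' this] have "\<forall>\<^sub>F n in sequentially.
      sqrt (2 * ln (2 * real (s n))) < Phi_inv ((1 + \<delta>) / 2) + quantile_bound 2 \<alpha>' (s n)"
    by (rule eventually_compose_filterlim) (intro filterlim_compose[OF filterlim_real_sequentially] s)
  moreover have "\<forall>\<^sub>F n in sequentially. 1 \<le> A n" "\<forall>\<^sub>F n in sequentially. 2 \<le> real (d n) / A n"
    using A dA unfolding filterlim_at_top by blast+
  ultimately show ?thesis using ev
  proof eventually_elim
    case (elim n)
    show ?case
    proof (rule ccontr)
      assume "\<not> 2 * s n \<le> d n"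
      moreover have "real (d n) / A n \<le> real (d n) / 1"
        using elim(2) by (intro divide_left_mono) auto
      ultimately have "real (d n) / A n - 1 \<le> 2 * real (s n)" by simp
      then have "ln (real (d n) / A n - 1) \<le> ln (2 * real (s n))"
        using elim(3) by (intro ln_mono) auto
      then have "sqrt (2 * ln (real (d n) / A n - 1)) \<le> sqrt (2 * ln (2 * real (s n)))"
        by simp
      then show False using elim(1,4) unfolding phi_ss_eq by linarith
    qed
  qed
qed

text \<open>In the second regime d - s may stay bounded, whereas the selection constraint and the
  tail bound at the threshold are secured once d - s is large; hence the bound N for membership,
  uniform in C' and in the sequences.\<close>

theorem corollary5p4:
  fixes \<alpha> \<alpha>' \<gamma> \<delta> :: real
  assumes "0 < \<delta>" "\<delta> < 1" "0 < \<alpha>" "\<alpha> < 1" "0 < \<gamma>" "\<gamma> < 1" "\<alpha>' = \<gamma> * \<alpha>"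
  shows
    "(\<forall>(d :: nat \<Rightarrow> nat) (s :: nat \<Rightarrow> nat) (a :: nat \<Rightarrow> real) (\<sigma> :: nat \<Rightarrow> real) (A :: nat \<Rightarrow> real).
        asymptotic_setting d s a \<sigma> \<and>
        filterlim A at_top sequentially \<and>
        filterlim (\<lambda>n. real (d n) / A n) at_top sequentially \<and>
        (\<forall>\<^sub>F n in sequentially. A n \<le> real (s n)) \<and>
        (\<forall>\<^sub>F n in sequentially. phi_ss (s n) \<alpha>' \<delta> \<le> a n / \<sigma> n \<and>
                               a n / \<sigma> n \<le> sqrt (2 * ln (real (d n) / A n - 1))) \<longrightarrow>
        1 \<le> minimax_length_liminf d s a \<sigma> \<alpha> \<delta> (\<lambda>n. \<sigma> n * sqrt (2 * ln (real (d n))) / 2) \<and>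
        TS_in_M d s a \<sigma> \<alpha> \<alpha>' \<delta> \<and>
        TS_length_limsup d s a \<sigma> \<alpha> \<alpha>' \<delta> (\<lambda>n. 2 * \<sigma> n * sqrt (2 * ln (real (d n)))) \<le> 1)
     \<and>
     (\<exists>C\<^sub>0 > 0. \<exists>N :: nat. \<forall>C' \<ge> C\<^sub>0.
      \<forall>(d :: nat \<Rightarrow> nat) (s :: nat \<Rightarrow> nat) (a :: nat \<Rightarrow> real) (\<sigma> :: nat \<Rightarrow> real).
        asymptotic_setting d s a \<sigma> \<and>
        (\<forall>\<^sub>F n in sequentially. s n < d n) \<and>
        (\<forall>\<^sub>F n in sequentially.
           a n / \<sigma> n \<ge>
             sqrt (2 * ln (real (d n) - real (s n)) - ln (ln (real (d n) - real (s n))) + C') +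
             sqrt (2 * ln (real (s n)) - ln (ln (real (s n))) + C')) \<longrightarrow>
        1 \<le> minimax_length_liminf d s a \<sigma> \<alpha> \<delta> (\<lambda>n. \<sigma> n * sqrt (2 * ln (real (s n))) / 2) \<and>
        ((\<forall>\<^sub>F n in sequentially. N \<le> d n - s n) \<longrightarrow> TS_in_M d s a \<sigma> \<alpha> \<alpha>' \<delta>) \<and>
        TS_length_limsup d s a \<sigma> \<alpha> \<alpha>' \<delta> (\<lambda>n. 2 * \<sigma> n * sqrt (2 * ln (real (s n)))) \<le> 1)"
proof -
  define \<beta> where "\<beta> = \<alpha> - \<alpha>'"
  have \<alpha>': "0 < \<alpha>'" "\<alpha>' < \<alpha>" using assms by auto
  have \<beta>: "0 < \<beta>" "\<beta> < 1" using \<alpha>' assms(4) by (simp_all add: \<beta>_def)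
  obtain N where N: "\<And>d s a \<sigma>. asymptotic_setting d s a \<sigma> \<Longrightarrow>
    \<forall>\<^sub>F n in sequentially. N \<le> d n - s n \<Longrightarrow>
    \<forall>\<^sub>F n in sequentially. phi_ss (s n) \<alpha>' \<delta> \<le> a n / \<sigma> n \<or> phi_bar (d n) (s n) \<alpha> \<alpha>' \<le> a n / \<sigma> n \<Longrightarrow>
    TS_in_M d s a \<sigma> \<alpha> \<alpha>' \<delta>"
    using TS_in_M_eventually[OF assms(1,2) \<alpha>'] by blast
  have dense: "1 \<le> minimax_length_liminf d s a \<sigma> \<alpha> \<delta> (\<lambda>n. \<sigma> n * sqrt (2 * ln (real (d n))) / 2) \<and>
      TS_in_M d s a \<sigma> \<alpha> \<alpha>' \<delta> \<and>
      TS_length_limsup d s a \<sigma> \<alpha> \<alpha>' \<delta> (\<lambda>n. 2 * \<sigma> n * sqrt (2 * ln (real (d n)))) \<le> 1"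
    if as: "asymptotic_setting d s a \<sigma>" and A: "filterlim A at_top sequentially"
      and dA: "filterlim (\<lambda>n. real (d n) / A n) at_top sequentially"
      and strength: "\<forall>\<^sub>F n in sequentially. phi_ss (s n) \<alpha>' \<delta> \<le> a n / \<sigma> n \<and>
        a n / \<sigma> n \<le> sqrt (2 * ln (real (d n) / A n - 1))"
    for d s a \<sigma> A
  proof (intro conjI)
    have d: "filterlim d at_top sequentially" and s: "filterlim s at_top sequentially"
      and \<sigma>: "\<And>n. 0 < \<sigma> n"
      using as by (auto simp: asymptotic_setting_def)
    have "\<forall>\<^sub>F n in sequentially. phi_ss (s n) \<alpha>' \<delta> \<le> sqrt (2 * ln (real (d n) / A n - 1))"
      using strength by (rule eventually_mono) linarith
    from two_sparsity_le_dimension[OF assms(1,2) \<alpha>'(1) s A dA this]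
    have sd: "\<forall>\<^sub>F n in sequentially. 2 * s n \<le> d n" .
    show "1 \<le> minimax_length_liminf d s a \<sigma> \<alpha> \<delta> (\<lambda>n. \<sigma> n * sqrt (2 * ln (real (d n))) / 2)"
      by (rule minimax_length_ge_sqrt_log_dimension[OF assms(3,4) as A dA])
        (use sd strength in \<open>auto elim: eventually_mono\<close>)
    have "\<forall>\<^sub>F n in sequentially. N \<le> s n" using s unfolding filterlim_at_top by blast
    with sd have "\<forall>\<^sub>F n in sequentially. N \<le> d n - s n"
      by eventually_elim linarith
    then show "TS_in_M d s a \<sigma> \<alpha> \<alpha>' \<delta>"
      by (rule N[OF as]) (use strength in \<open>auto elim: eventually_mono\<close>)
    have "\<forall>\<^sub>F n in sequentially. quantile_bound 2 \<beta> (d n) \<le> sqrt (2 * ln (2 / \<beta> * d n))"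
      "\<forall>\<^sub>F n in sequentially. quantile_bound 4 \<beta> (s n) \<le> sqrt (2 * ln (4 / \<beta> * s n))"
      by (rule quantile_bound_le; use \<beta> d s in simp)+
    moreover have "\<forall>\<^sub>F n in sequentially. 1 \<le> s n"
      using s unfolding filterlim_at_top by blast
    \<comment> \<open>The signal window may reach beyond \<open>phi_bar\<close>, so both half-widths
      have to be covered; 4 / \<beta> together with s \<le> d dominates both.\<close>
    ultimately have "\<forall>\<^sub>F n in sequentially.
        TS_halfwidth (d n) (s n) (a n) (\<sigma> n) \<alpha> \<alpha>' \<le> sqrt (2 * ln (4 / \<beta> * (real (d n) + 0)))"
      using sd
    proof eventually_elim
      case (elim n)
      have "ln (2 / \<beta> * d n) \<le> ln (4 / \<beta> * (real (d n) + 0))"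
        "ln (4 / \<beta> * s n) \<le> ln (4 / \<beta> * (real (d n) + 0))"
        using elim \<beta> by (auto intro!: ln_mono mult_mono divide_right_mono)
      then have "sqrt (2 * ln (2 / \<beta> * d n)) \<le> sqrt (2 * ln (4 / \<beta> * (real (d n) + 0)))"
        "sqrt (2 * ln (4 / \<beta> * s n)) \<le> sqrt (2 * ln (4 / \<beta> * (real (d n) + 0)))"
        by (auto intro!: real_sqrt_le_mono)
      then show ?case
        using elim unfolding TS_halfwidth_eq \<beta>_def[symmetric] by (auto intro: order_trans)
    qed
    then show "TS_length_limsup d s a \<sigma> \<alpha> \<alpha>' \<delta> (\<lambda>n. 2 * \<sigma> n * sqrt (2 * ln (real (d n)))) \<le> 1"
      by (rule TS_length_limsup_le[OF \<sigma> d _ order_refl, rotated]) (use \<beta> in simp)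
  qed
  \<comment> \<open>The two logarithms are what \<open>quantile_bound_le_loglog\<close> requires for
    the two summands of \<open>phi_bar\<close>; the 1 ensures positivity.\<close>
  define C\<^sub>0 where "C\<^sub>0 = max 1 (max (2 * ln (4 / \<beta>)) (2 * ln (2 / \<alpha>')))"
  \<comment> \<open>The 2 puts d - s above 1, where the double logarithm is meaningful and the
    comparison with \<open>phi_bar\<close> applies.\<close>
  define N' where "N' = max 2 N"
  have sparse: "1 \<le> minimax_length_liminf d s a \<sigma> \<alpha> \<delta> (\<lambda>n. \<sigma> n * sqrt (2 * ln (real (s n))) / 2) \<and>
      ((\<forall>\<^sub>F n in sequentially. N' \<le> d n - s n) \<longrightarrow> TS_in_M d s a \<sigma> \<alpha> \<alpha>' \<delta>) \<and>
      TS_length_limsup d s a \<sigma> \<alpha> \<alpha>' \<delta> (\<lambda>n. 2 * \<sigma> n * sqrt (2 * ln (real (s n)))) \<le> 1"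
    if C': "C\<^sub>0 \<le> C'" and as: "asymptotic_setting d s a \<sigma>"
      and sd: "\<forall>\<^sub>F n in sequentially. s n < d n"
      and strength: "\<forall>\<^sub>F n in sequentially. a n / \<sigma> n \<ge>
        sqrt (2 * ln (real (d n) - real (s n)) - ln (ln (real (d n) - real (s n))) + C') +
        sqrt (2 * ln (real (s n)) - ln (ln (real (s n))) + C')"
    for C' d s a \<sigma>
  proof (intro conjI impI)
    have s: "filterlim s at_top sequentially" and \<sigma>: "\<And>n. 0 < \<sigma> n"
      using as by (auto simp: asymptotic_setting_def)
    have s2: "\<forall>\<^sub>F n in sequentially. 2 \<le> s n" using s unfolding filterlim_at_top by blast
    show "1 \<le> minimax_length_liminf d s a \<sigma> \<alpha> \<delta> (\<lambda>n. \<sigma> n * sqrt (2 * ln (real (s n))) / 2)"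
      by (rule minimax_length_ge_sqrt_log_sparsity[OF assms(3,4) as])
        (use sd in \<open>auto elim: eventually_mono\<close>)
    have strong: "\<forall>\<^sub>F n in sequentially. 2 \<le> d n - s n \<longrightarrow> phi_bar (d n) (s n) \<alpha> \<alpha>' \<le> a n / \<sigma> n"
      using strength s2
    proof eventually_elim
      case (elim n)
      show ?case
      proof
        assume D: "2 \<le> d n - s n"
        have "quantile_bound 4 \<beta> (real (d n) - real (s n)) \<le>
            sqrt (2 * ln (real (d n) - real (s n)) - ln (ln (real (d n) - real (s n))) + C')"
          by (rule quantile_bound_le_loglog) (use \<beta> C' D in \<open>auto simp: C\<^sub>0_def\<close>)
        moreover have "quantile_bound 2 \<alpha>' (s n) \<le>
            sqrt (2 * ln (real (s n)) - ln (ln (real (s n))) + C')"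
          by (rule quantile_bound_le_loglog) (use \<alpha>' assms(4) C' elim(2) in \<open>auto simp: C\<^sub>0_def\<close>)
        ultimately show "phi_bar (d n) (s n) \<alpha> \<alpha>' \<le> a n / \<sigma> n"
          using elim(1) unfolding phi_bar_eq \<beta>_def by linarith
      qed
    qed
    show "TS_in_M d s a \<sigma> \<alpha> \<alpha>' \<delta>" if D: "\<forall>\<^sub>F n in sequentially. N' \<le> d n - s n"
    proof (rule N[OF as])
      show "\<forall>\<^sub>F n in sequentially. N \<le> d n - s n"
        using D by (rule eventually_mono) (simp add: N'_def)
      show "\<forall>\<^sub>F n in sequentially.
          phi_ss (s n) \<alpha>' \<delta> \<le> a n / \<sigma> n \<or> phi_bar (d n) (s n) \<alpha> \<alpha>' \<le> a n / \<sigma> n"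
        using D strong by eventually_elim (simp add: N'_def)
    qed
    have "\<forall>\<^sub>F n in sequentially. quantile_bound 2 \<beta> (d n) \<le> sqrt (2 * ln (2 / \<beta> * d n))"
      "\<forall>\<^sub>F n in sequentially. quantile_bound 4 \<beta> (s n) \<le> sqrt (2 * ln (4 / \<beta> * s n))"
      by (rule quantile_bound_le; use \<beta> as in \<open>simp add: asymptotic_setting_def\<close>)+
    \<comment> \<open>If d - s is at least 2, the second regime is in force and its width depends on
      s. Otherwise the width may be the one for d, but then d \<le> s + 2, which explains the
      shift.\<close>
    with sd s2 strong have "\<forall>\<^sub>F n in sequentially.
        TS_halfwidth (d n) (s n) (a n) (\<sigma> n) \<alpha> \<alpha>' \<le> sqrt (2 * ln (4 / \<beta> * (real (s n) + real 2)))"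
    proof eventually_elim
      case (elim n)
      let ?w = "sqrt (2 * ln (4 / \<beta> * (real (s n) + real 2)))"
      have "ln (4 / \<beta> * s n) \<le> ln (4 / \<beta> * (real (s n) + real 2))"
        using elim \<beta> by (auto intro!: ln_mono mult_mono divide_right_mono)
      then have "sqrt (2 * ln (4 / \<beta> * s n)) \<le> ?w"
        by (auto intro!: real_sqrt_le_mono)
      moreover have "sqrt (2 * ln (2 / \<beta> * d n)) \<le> ?w" if "\<not> 2 \<le> d n - s n"
      proof -
        have "real (d n) \<le> real (s n) + real 2" using that by linarith
        then have "ln (2 / \<beta> * d n) \<le> ln (4 / \<beta> * (real (s n) + real 2))"
          using elim \<beta> by (auto intro!: ln_mono mult_mono divide_right_mono)
        then show ?thesis by (auto intro!: real_sqrt_le_mono)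
      qed
      ultimately show ?case
        using elim unfolding TS_halfwidth_eq \<beta>_def[symmetric] by (auto intro: order_trans)
    qed
    then show "TS_length_limsup d s a \<sigma> \<alpha> \<alpha>' \<delta> (\<lambda>n. 2 * \<sigma> n * sqrt (2 * ln (real (s n)))) \<le> 1"
      by (rule TS_length_limsup_le[OF \<sigma> s _ of_nat_0_le_iff, rotated]) (use \<beta> in simp)
  qed
  have "0 < C\<^sub>0" by (simp add: C\<^sub>0_def)
  show ?thesis
    using dense \<open>0 < C\<^sub>0\<close> sparse by blast
qed

end
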